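(* Assume the following (all notation as in the context). (A1) $\{x_t\}$ is a strictly stationary and ergodic solution of the vMEM $x_t=\mu_t\odot\varepsilon_t$, $\mu_t=\mu(\vartheta;\mathcal F_{t-1})$, for the parameter $\vartheta=\vartheta_0$ and innovations $\{\varepsilon_t\}$ with distribution $F_\varepsilon$. The point $\vartheta_0$ belongs to a compact set $\Omega_0\subset\mathbb R^K$, and $\mu=(\mu_1,\dots,\mu_d)^\top$ satisfies $\mu_j(\vartheta;\cdot)\ge\omega_0$ for all $j=1,\dots,d$, all $\vartheta\in\Omega_0$ and some $\omega_0>0$. Furthermore there exist $K_0>0$ and $\rho\in(0,1)$ such that $\|\mu(\vartheta;\widetilde{\mathcal F}_t)-\mu(\vartheta;\mathcal F_t)\|<K_0\rho^t$ for all $t$ and all $\vartheta\in\Omega_0$. (A4) $\mu(\vartheta;\cdot)$ is twice continuously differentiable with respect to $\vartheta$ on the interior of $\Omega_0$; $\mathsf E\|x_t\|<\infty$ and $$\mathsf E\Bigl\{\Bigl|\frac{\partial\mu_j}{\partial\vartheta_k}(\vartheta_0;\mathcal F_{t-1})\Bigr|\frac{\varepsilon_{t,j}}{\mu_j(\vartheta_0;\mathcal F_{t-1})}\Bigr\}<\infty$$ for all $j=1,\dots,d$, $k=1,\dots,K$; and there is a neighbourhood $U(\vartheta_0)$ of $\vartheta_0$ such that $$\mathsf E\Bigl\{\|x_t\|^2\sup_{\vartheta\in U(\vartheta_0)}\Bigl|\frac{\partial\mu_j(\vartheta;\mathcal F_{t-1})}{\partial\vartheta_k}\frac{\partial\mu_j(\vartheta;\mathcal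 F_{t-1})}{\partial\vartheta_l}\Bigr|\Bigr\}<\infty,\qquad \mathsf E\Bigl\{|x_{t,j}|\sup_{\vartheta\in U(\vartheta_0)}\Bigl|\frac{\partial^2\mu_j(\vartheta;\mathcal F_{t-1})}{\partial\vartheta_k\partial\vartheta_l}\Bigr|\Bigr\}<\infty$$ for all $j=1,\dots,d$, $k,l=1,\dots,K$. (A5) $W:\mathbb R^d_+\to[0,\infty)$ is an integrable function such that $\int_{\mathbb R^d_+}\|u\|^4W(u)\,\mathrm du<\infty$. Assume also that, as $T\to\infty$, $$\sqrt T(\widehat\vartheta_T-\vartheta_0)=\frac1{\sqrt T}\sum_{t=1}^Tm_{t,1}+o_{\mathsf P}(1),$$ where $\{m_{t,1}\}$ is a strictly stationary sequence of martingale differences with respect to $\{\mathcal F^\varepsilon_{t-1}\}$, $\mathcal F^\varepsilon_{t-1}=\sigma\{\varepsilon_s,\ s\le t-1\}$, with a finite variance matrix. Let $F_\varepsilon\notin\mathcal G$, and assume that $L_{\widehat\varphi_T}(u)\to L_{\varphi_A}(u)$ in probability, uniformly in $u\in\mathbb R^d_+$, for some $\varphi_A\in\Phi$. Then, as $T\to\infty$, $$\frac{S_{T,W}}{T}\ \longrightarrow\ \int_{\mathbb R^d_+}\bigl|L_\varepsilon(u)-L_{\varphi_A}(u)\bigr|^2W(u)\,\mathrm du\quad\text{in probability},$$ where $L_\varepsilon(u)=\mathsf E\,\mathrm e^{-u^\top\varepsilon_1}$ is the Laplace transform of $\varepsilon_t$.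
   Context: Notation: $\mathbb R^d_+=(0,\infty)^d$; $\odot$ and $\oslash$ are the elementwise product and elementwise division of vectors; $o_{\mathsf P}(1)$ is as $T\to\infty$. Model (vMEM): $\{x_t\}$, $x_t=(x_{t,1},\dots,x_{t,d})^\top$, $d\ge1$, is a time series of non-negative $d$-dimensional random vectors, $\mathcal F_t=\sigma\{x_s,\ s\le t\}$, and $$x_t=\mu_t\odot\varepsilon_t,\qquad \mu_t=\mu(\vartheta;\mathcal F_{t-1}),$$ where $\{\varepsilon_t\}$ are independent copies of a non-negative $d$-dimensional random vector $\varepsilon$ with distribution function $F_\varepsilon$ and $\mathsf E\varepsilon=(1,\dots,1)^\top$, and $\mu$ is a given function specifying the dependence of $\mu_t=\mathsf E(x_t\mid\mathcal F_{t-1})$ on the past through the parameter $\vartheta\in\mathbb R^K$, $K\ge1$. Finite past: $\widetilde{\mathcal F}_t=\sigma\{x_s,\ 1\le s\le t\}$; $\mu(\vartheta;\widetilde{\mathcal F}_t)$ denotes the conditional-mean function computed (recursively) from $x_1,\dots,x_t$ with some specified initial values in place of the unobserved quantities at times $\le 0$. Data and residuals: $x_1,\dots,x_T$ are observed; $\widehat\vartheta_T$ is an estimator of $\vartheta$; $\widehat\mu_t=\mu(\widehat\vartheta_T;\widetilde{\mathcal F}_{t-1})$ and $\widehat\varepsilon_t=x_t\oslash\widehat\mu_t$, $t=1,\dots,T$. Parametric family: $\mathcal G=\{G_\varphi:\varphi\in\Phi\}$, $\Phi\subseteq\mathbb R^r$, $r\ge1$, is a family of distributions on $\mathbb R^d_+$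 with Laplace transforms $L_\varphi(u)=\int_{\mathbb R^d_+}\mathrm e^{-u^\top y}\,\mathrm dG_\varphi(y)$, $u\in\mathbb R^d_+$; $\widehat\varphi_T$ is an estimator of $\varphi$ with values in $\Phi$. Test statistic: with $\widehat L_T(u)=\frac1T\sum_{t=1}^T\mathrm e^{-u^\top\widehat\varepsilon_t}$, $$S_{T,W}=T\int_{\mathbb R^d_+}\bigl[\widehat L_T(u)-L_{\widehat\varphi_T}(u)\bigr]^2W(u)\,\mathrm du .$$ *)

theory Defs
  imports "HOL-Probability.Probability"
begin

definition pos_orthant :: "(real ^ 'd) set" where
  "pos_orthant = {u. \<forall>j. 0 < u $ j}"

text \<open>The elementwise product of vectors is the library's \<open>*\<close> on \<open>real ^ 'd\<close>, the vector
  \<open>(1, ..., 1)\<close> is \<open>1\<close>, and \<open>\<le>\<close> is the componentwise order.\<close>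

definition vec_div :: "real ^ 'd \<Rightarrow> real ^ 'd \<Rightarrow> real ^ 'd" (infixl "\<oslash>" 70) where
  "x \<oslash> y = (\<chi> j. x $ j / y $ j)"


subsection \<open>Time series\<close>

definition sigma_of :: "'w measure \<Rightarrow> (int \<Rightarrow> 'w \<Rightarrow> 'b :: topological_space) \<Rightarrow> int set \<Rightarrow> 'w measure" where
  "sigma_of M X I = sigma (space M) (\<Union>s\<in>I. {X s -` A \<inter> space M | A. A \<in> sets borel})"

definition strictly_stationary :: "'w measure \<Rightarrow> (int \<Rightarrow> 'w \<Rightarrow> 'b :: topological_space) \<Rightarrow> bool" where
  "strictly_stationary M X \<longleftrightarrow>
     (\<forall>t. X t \<in> borel_measurable M) \<and>
     (\<forall>h. distr M (\<Pi>\<^sub>M t\<in>UNIV. borel) (\<lambda>\<omega> t. X (t + h) \<omega>)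
        = distr M (\<Pi>\<^sub>M t\<in>UNIV. borel) (\<lambda>\<omega> t. X t \<omega>))"

text \<open>Ergodicity of the law of \<open>X\<close> on path space under the left shift; to be used together with
  stationarity.\<close>

definition ergodic_process :: "'w measure \<Rightarrow> (int \<Rightarrow> 'w \<Rightarrow> 'b :: topological_space) \<Rightarrow> bool" where
  "ergodic_process M X \<longleftrightarrow>
     (\<forall>A \<in> sets (\<Pi>\<^sub>M t\<in>(UNIV :: int set). (borel :: 'b measure)).
        (\<lambda>z t. z (t + 1)) -` A = A \<longrightarrow>
        measure M {\<omega> \<in> space M. (\<lambda>t. X t \<omega>) \<in> A} \<in> {0, 1})"

definition martingale_differences ::
    "'w measure \<Rightarrow> (int \<Rightarrow> 'w measure) \<Rightarrow> (int \<Rightarrow> 'w \<Rightarrow> real ^ 'k) \<Rightarrow> bool" where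
  "martingale_differences M F m \<longleftrightarrow>
     (\<forall>t. m t \<in> borel_measurable (F t) \<and> integrable M (m t) \<and>
        (\<forall>k. AE \<omega> in M. real_cond_exp M (F (t - 1)) (\<lambda>\<omega>. m t \<omega> $ k) \<omega> = 0))"

text \<open>Convergence in probability to a constant. For measurable \<open>X T\<close> the outer measure is the
  measure itself and this is the usual notion. The outer measure is used because quantities such
  as suprema over uncountable sets, or \<open>\<mu>\<close> evaluated at an estimator, need not be measurable:
  with \<open>measure M\<close> a non-measurable event would silently get probability 0.\<close>

definition conv_in_prob :: "'w measure \<Rightarrow> (nat \<Rightarrow> 'w \<Rightarrow> 'b :: metric_space) \<Rightarrow> 'b \<Rightarrow> bool" where
  "conv_in_prob M X c \<longleftrightarrow>
     (\<forall>e>0. (\<lambda>T. outer_measure_of M {\<omega> \<in> space M. e < dist (X T \<omega>) c}) \<longlonglongrightarrow> 0)"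


subsection \<open>Smoothness in the parameter\<close>

definition partial :: "'k \<Rightarrow> (real ^ 'k \<Rightarrow> real) \<Rightarrow> real ^ 'k \<Rightarrow> real" where
  "partial k f v = frechet_derivative f (at v) (axis k 1)"

text \<open>For an open set: differentiable with continuous derivative, the derivative being
  represented by its coordinates.\<close>

definition C1_on :: "(real ^ 'k) set \<Rightarrow> (real ^ 'k \<Rightarrow> real) \<Rightarrow> bool" where
  "C1_on S f \<longleftrightarrow> (\<forall>v\<in>S. f differentiable (at v)) \<and> (\<forall>k. continuous_on S (partial k f))"

definition C2_on :: "(real ^ 'k) set \<Rightarrow> (real ^ 'k \<Rightarrow> real) \<Rightarrow> bool" where
  "C2_on S f \<longleftrightarrow> C1_on S f \<and> (\<forall>k. C1_on S (partial k f))"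


subsection \<open>The conditional mean and the test statistic\<close>

text \<open>\<open>past x t \<omega> = (x\<^sub>t, x\<^sub>t\<^sub>-\<^sub>1, ...)\<close>, so that \<open>\<mu>(\<theta>; F\<^sub>t)\<close> is \<open>\<mu> \<theta> (past x t \<omega>)\<close>.\<close>

definition past :: "(int \<Rightarrow> 'w \<Rightarrow> 'b) \<Rightarrow> int \<Rightarrow> 'w \<Rightarrow> nat \<Rightarrow> 'b" where
  "past x t \<omega> = (\<lambda>i. x (t - int i) \<omega>)"

text \<open>Let \<open>g\<close> compute the conditional mean at time \<open>t + 1\<close> from the observations
  \<open>x\<^sub>t, x\<^sub>t\<^sub>-\<^sub>1, ...\<close> and the conditional means at times \<open>t, t - 1, ...\<close>. Then
  \<open>mu_finite g x0 m0 \<theta> y t\<close> is the conditional mean at time \<open>t + 1\<close> computed by this recursion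
  from \<open>y 1, ..., y t\<close>, where for \<open>s \<ge> 0\<close> the unobserved \<open>x\<^sub>-\<^sub>s\<close> and \<open>\<mu>\<^sub>-\<^sub>s\<close> are replaced by
  the initial values \<open>x0 \<theta> s\<close> and \<open>m0 \<theta> s\<close>. A non-recursive specification is a \<open>g\<close> that ignores
  its last argument.\<close>

fun mu_finite ::
    "(real ^ 'k \<Rightarrow> (nat \<Rightarrow> real ^ 'd) \<Rightarrow> (nat \<Rightarrow> real ^ 'd) \<Rightarrow> real ^ 'd) \<Rightarrow>
     (real ^ 'k \<Rightarrow> nat \<Rightarrow> real ^ 'd) \<Rightarrow> (real ^ 'k \<Rightarrow> nat \<Rightarrow> real ^ 'd) \<Rightarrow>
     real ^ 'k \<Rightarrow> (nat \<Rightarrow> real ^ 'd) \<Rightarrow> nat \<Rightarrow> real ^ 'd" where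
  "mu_finite g x0 m0 \<theta> y t =
     g \<theta> (\<lambda>i. if i < t then y (t - i) else x0 \<theta> (i - t))
         (\<lambda>i. if i < t then mu_finite g x0 m0 \<theta> y (t - Suc i) else m0 \<theta> (i - t))"

declare mu_finite.simps [simp del]

definition laplace :: "(real ^ 'd) measure \<Rightarrow> real ^ 'd \<Rightarrow> real" where
  "laplace D u = (LINT y:pos_orthant|D. exp (- (u \<bullet> y)))"

definition emp_laplace :: "(nat \<Rightarrow> real ^ 'd) \<Rightarrow> nat \<Rightarrow> real ^ 'd \<Rightarrow> real" where
  "emp_laplace e T u = (1 / real T) * (\<Sum>t=1..T. exp (- (u \<bullet> e t)))"

definition test_stat ::
    "(real ^ 'd \<Rightarrow> real) \<Rightarrow> (nat \<Rightarrow> real ^ 'd) \<Rightarrow> (real ^ 'd) measure \<Rightarrow> nat \<Rightarrow> real" where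
  "test_stat W e D T =
     real T * (LINT u:pos_orthant|lborel. (emp_laplace e T u - laplace D u)\<^sup>2 * W u)"

end

theory Submission
  imports Defs
begin

text \<open>Let \<open>L\<^sub>T\<close> be the empirical Laplace transform of the true innovations. By independence
  \<open>E \<bar>L\<^sub>T u - L\<^sub>\<epsilon> u\<bar> \<le> 1 / sqrt T\<close> for each \<open>u\<close>, and Tonelli turns this into convergence to 0 of the
  integral of \<open>\<bar>L\<^sub>T - L\<^sub>\<epsilon>\<bar> W\<close>. The residuals replace \<open>L\<^sub>T\<close> by a function that differs from it by at most
  \<open>1 / T + C \<bar>u\<bar> (K\<^sub>0 P\<^sub>T + \<bar>\<theta>\<^sub>T - \<theta>\<^sub>0\<bar> Q\<^sub>T)\<close>, where \<open>P\<^sub>T\<close> is the average of \<open>\<bar>x\<^sub>t\<bar> \<rho>\<^sup>t\<^sup>-\<^sup>1\<close>, with mean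
  \<open>O(1 / T)\<close>, and \<open>Q\<^sub>T\<close> is the average of \<open>\<bar>x\<^sub>t\<bar>\<close> times a local bound of the gradient of \<open>\<mu>\<close>, with bounded
  mean by stationarity. The expansion of the estimator gives its consistency, because averages of
  square integrable martingale differences tend to 0 in \<open>L\<^sup>2\<close>. Finally all Laplace transforms
  take values in \<open>[0, 1]\<close>, where squaring differences is Lipschitz.\<close>

subsection \<open>Convergence in probability under the outer measure\<close>

text \<open>\<open>S T\<close> need not be measurable: it evaluates the conditional mean and
  \<open>laplace (G \<phi>)\<close> at random parameters. Its expectation is therefore never taken.
  Instead its scaled distance to the limit is dominated, path by path outside a null set, by a sum
  \<open>X T\<close> whose terms are treated separately: the measurable ones through their means and
  Markov's inequality, the others through measurable exceptional sets. The domination is only local.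
  The lower bound on \<open>\<mu>\<close> is assumed on \<open>\<Omega>0\<close> and the gradient is
  controlled on \<open>U\<close>, while the estimator may leave both; consistency makes this event
  negligible. The factor \<open>norm u\<close> arises because \<open>exp (- a)\<close> is
  1-Lipschitz for nonnegative \<open>a\<close>. The constant \<open>C\<close> is
  \<open>real CARD('d) / \<omega>0\<^sup>2\<close>: the two conditional means in the denominators
  are at least \<open>\<omega>0\<close>, and the Euclidean norm of the residual error is bounded by
  the sum of its coordinates.\<close>

lemma outer_measure_of_le_emeasure:
  "E \<in> sets M \<Longrightarrow> A \<subseteq> E \<Longrightarrow> outer_measure_of M A \<le> emeasure M E"
  using outer_measure_of_mono[of A E M] by simp

text \<open>The outer measure of a set is attained by a measurable cover \<open>E\<close>, so all
  later estimates can use ordinary measures of exceptional sets although \<open>X T\<close> need not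
  be measurable. One number \<open>e\<close> bounds both the distance and the probability, as in the
  Ky Fan metric; \<open>conv_in_probD\<close> separates the two again.\<close>

lemma conv_in_prob_iff:
  "conv_in_prob M X c \<longleftrightarrow>
     (\<forall>e>0. \<forall>\<^sub>F T in sequentially. \<exists>E\<in>sets M. emeasure M E < ennreal e \<and>
        (\<forall>\<omega>\<in>space M - E. dist (X T \<omega>) c \<le> e))" (is "?L \<longleftrightarrow> ?R")
proof
  assume L: ?L
  show ?R
  proof (intro allI impI)
    fix e :: real assume e: "e > 0"
    have "(\<lambda>T. outer_measure_of M {\<omega> \<in> space M. e < dist (X T \<omega>) c}) \<longlonglongrightarrow> 0"
      using L e by (auto simp: conv_in_prob_def)
    then have "\<forall>\<^sub>F T in sequentially. outer_measure_of M {\<omega> \<in> space M. e < dist (X T \<omega>) c} < ennreal e"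
      by (rule order_tendstoD) (use e in simp)
    then show "\<forall>\<^sub>F T in sequentially. \<exists>E\<in>sets M. emeasure M E < ennreal e \<and>
        (\<forall>\<omega>\<in>space M - E. dist (X T \<omega>) c \<le> e)"
    proof eventually_elim
      case (elim T)
      obtain E where "E \<in> sets M" "{\<omega> \<in> space M. e < dist (X T \<omega>) c} \<subseteq> E"
        "outer_measure_of M {\<omega> \<in> space M. e < dist (X T \<omega>) c} = emeasure M E"
        using outer_measure_of_attain[of "{\<omega> \<in> space M. e < dist (X T \<omega>) c}" M] by auto
      with elim show ?case by (intro bexI[of _ E]) (auto simp: not_less[symmetric])
    qed
  qed
next
  assume R: ?R
  show ?L unfolding conv_in_prob_def
  proof (intro allI impI tendsto_zero_ennreal)
    fix e r :: real assume e: "e > 0" "r > 0"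
    have "\<forall>\<^sub>F T in sequentially. \<exists>E\<in>sets M. emeasure M E < ennreal (min e r) \<and>
        (\<forall>\<omega>\<in>space M - E. dist (X T \<omega>) c \<le> min e r)"
      by (rule R[rule_format]) (use e in simp)
    then show "\<forall>\<^sub>F T in sequentially. outer_measure_of M {\<omega> \<in> space M. e < dist (X T \<omega>) c} < ennreal r"
    proof eventually_elim
      case (elim T)
      then obtain E where E: "E \<in> sets M" "emeasure M E < ennreal (min e r)"
        "\<forall>\<omega>\<in>space M - E. dist (X T \<omega>) c \<le> min e r" by auto
      then have "outer_measure_of M {\<omega> \<in> space M. e < dist (X T \<omega>) c} \<le> emeasure M E"
        by (intro outer_measure_of_le_emeasure) force+
      also have "\<dots> < ennreal (min e r)" by fact
      also have "\<dots> \<le> ennreal r" by (intro ennreal_leI) simp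
      finally show ?case .
    qed
  qed
qed

lemma conv_in_probD:
  assumes "conv_in_prob M X c" "0 < e" "0 < d"
  shows "\<forall>\<^sub>F T in sequentially. \<exists>E\<in>sets M. emeasure M E < ennreal d \<and>
        (\<forall>\<omega>\<in>space M - E. dist (X T \<omega>) c \<le> e)"
proof -
  have "\<forall>\<^sub>F T in sequentially. \<exists>E\<in>sets M. emeasure M E < ennreal (min d e) \<and>
        (\<forall>\<omega>\<in>space M - E. dist (X T \<omega>) c \<le> min d e)"
    by (rule assms(1)[unfolded conv_in_prob_iff, rule_format]) (use assms in simp)
  then show ?thesis
  proof eventually_elim
    case (elim T)
    have "ennreal (min d e) \<le> ennreal d" by (intro ennreal_leI) simp
    with elim show ?case by (meson min.bounded_iff order_less_le_trans)
  qed
qed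

text \<open>Localised domination. In the application \<open>Z\<close> is the estimation error, and
  the inequality between \<open>Y\<close> and \<open>X\<close> is available only while
  \<open>Z\<close> is within \<open>r\<close> of its limit. The exceptional sets of \<open>Z\<close>
  and of \<open>X\<close> cost \<open>e/2\<close> each, and the null set nothing.\<close>

lemma conv_in_prob_dominated:
  fixes Y :: "nat \<Rightarrow> 'w \<Rightarrow> 'b :: metric_space" and X :: "nat \<Rightarrow> 'w \<Rightarrow> real"
  assumes Z: "conv_in_prob M Z z" "0 < r" and X: "conv_in_prob M X 0"
    and le: "\<forall>\<^sub>F T in sequentially. AE \<omega> in M. dist (Z T \<omega>) z < r \<longrightarrow> dist (Y T \<omega>) c \<le> X T \<omega>"
  shows "conv_in_prob M Y c"
  unfolding conv_in_prob_iff
proof (intro allI impI)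
  fix e :: real assume e: "e > 0"
  show "\<forall>\<^sub>F T in sequentially. \<exists>E\<in>sets M. emeasure M E < ennreal e \<and>
        (\<forall>\<omega>\<in>space M - E. dist (Y T \<omega>) c \<le> e)"
    using conv_in_probD[OF Z(1) half_gt_zero[OF Z(2)] half_gt_zero[OF e]]
      conv_in_probD[OF X e half_gt_zero[OF e]] le
  proof eventually_elim
    case (elim T)
    obtain E1 where E1: "E1 \<in> sets M" "emeasure M E1 < ennreal (e/2)"
      "\<forall>\<omega>\<in>space M - E1. dist (Z T \<omega>) z \<le> r/2" using elim(1) e \<open>0 < r\<close> by auto
    obtain E2 where E2: "E2 \<in> sets M" "emeasure M E2 < ennreal (e/2)"
      "\<forall>\<omega>\<in>space M - E2. dist (X T \<omega>) 0 \<le> e" using elim(2) e by auto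
    obtain N where N: "{\<omega>\<in>space M. \<not> (dist (Z T \<omega>) z < r \<longrightarrow> dist (Y T \<omega>) c \<le> X T \<omega>)} \<subseteq> N"
      "N \<in> null_sets M" using elim(3) by (auto simp: eventually_ae_filter)
    have [measurable]: "N \<in> sets M" using N by auto
    have "emeasure M (E1 \<union> E2 \<union> N) = emeasure M (E1 \<union> E2)"
      using N(2) E1 E2 by (intro emeasure_Un_null_set) auto
    also have "\<dots> \<le> emeasure M E1 + emeasure M E2"
      by (intro emeasure_subadditive E1 E2)
    also have "\<dots> < ennreal (e/2) + ennreal (e/2)"
      by (intro add_strict_mono E1 E2)
    also have "\<dots> = ennreal e" using e by (simp flip: ennreal_plus)
    finally have "emeasure M (E1 \<union> E2 \<union> N) < ennreal e" .
    moreover have "dist (Y T \<omega>) c \<le> e" if w: "\<omega> \<in> space M - (E1 \<union> E2 \<union> N)" for \<omega>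
    proof -
      \<comment> \<open>The exceptional set yields only a non-strict bound; it was taken for radius
        \<open>r/2\<close> to get strictness here.\<close>
      have "dist (Z T \<omega>) z < r" using E1(3) w \<open>0 < r\<close> by force
      then have "dist (Y T \<omega>) c \<le> X T \<omega>" using N(1) w by auto
      also have "\<dots> \<le> e" using E2(3) w by (force simp: dist_real_def)
      finally show ?thesis .
    qed
    ultimately show ?case using E1 E2 \<open>N \<in> sets M\<close> by (intro bexI[of _ "E1 \<union> E2 \<union> N"]) auto
  qed
qed

lemma conv_in_prob_add:
  fixes X Y :: "nat \<Rightarrow> 'w \<Rightarrow> 'b :: real_normed_vector"
  assumes "conv_in_prob M X a" "conv_in_prob M Y b"
  shows "conv_in_prob M (\<lambda>T \<omega>. X T \<omega> + Y T \<omega>) (a + b)"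
  unfolding conv_in_prob_iff
proof (intro allI impI)
  fix e :: real assume e: "e > 0"
  show "\<forall>\<^sub>F T in sequentially. \<exists>E\<in>sets M. emeasure M E < ennreal e \<and>
        (\<forall>\<omega>\<in>space M - E. dist (X T \<omega> + Y T \<omega>) (a + b) \<le> e)"
    using conv_in_probD[OF assms(1) half_gt_zero[OF e] half_gt_zero[OF e]]
      conv_in_probD[OF assms(2) half_gt_zero[OF e] half_gt_zero[OF e]]
  proof eventually_elim
    case (elim T)
    obtain E1 where E1: "E1 \<in> sets M" "emeasure M E1 < ennreal (e/2)"
      "\<forall>\<omega>\<in>space M - E1. dist (X T \<omega>) a \<le> e/2" using elim(1) e by auto
    obtain E2 where E2: "E2 \<in> sets M" "emeasure M E2 < ennreal (e/2)"
      "\<forall>\<omega>\<in>space M - E2. dist (Y T \<omega>) b \<le> e/2" using elim(2) e by auto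
    have "emeasure M (E1 \<union> E2) \<le> emeasure M E1 + emeasure M E2"
      by (intro emeasure_subadditive E1 E2)
    also have "\<dots> < ennreal (e/2) + ennreal (e/2)"
      by (intro add_strict_mono E1 E2)
    also have "\<dots> = ennreal e" using e by (simp flip: ennreal_plus)
    finally have "emeasure M (E1 \<union> E2) < ennreal e" .
    moreover have "dist (X T \<omega> + Y T \<omega>) (a + b) \<le> e" if "\<omega> \<in> space M - (E1 \<union> E2)" for \<omega>
      using dist_triangle_add[of "X T \<omega>" "Y T \<omega>" a b] E1(3) E2(3) that by force
    ultimately show ?case using E1 E2 by (intro bexI[of _ "E1 \<union> E2"]) auto
  qed
qed

lemma conv_in_prob_norm_le:
  fixes X :: "nat \<Rightarrow> 'w \<Rightarrow> 'b :: real_normed_vector" and Y :: "nat \<Rightarrow> 'w \<Rightarrow> 'c :: real_normed_vector"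
  assumes "conv_in_prob M X 0" "\<forall>\<^sub>F T in sequentially. \<forall>\<omega>\<in>space M. norm (Y T \<omega>) \<le> B * norm (X T \<omega>)"
  shows "conv_in_prob M Y 0"
  unfolding conv_in_prob_iff
proof (intro allI impI)
  fix e :: real assume e: "e > 0"
  define C where "C = max 1 B"
  have C: "C > 0" "B \<le> C" by (auto simp: C_def)
  show "\<forall>\<^sub>F T in sequentially. \<exists>E\<in>sets M. emeasure M E < ennreal e \<and>
        (\<forall>\<omega>\<in>space M - E. dist (Y T \<omega>) 0 \<le> e)"
    using conv_in_probD[OF assms(1) divide_pos_pos[OF e C(1)] e] assms(2)
  proof eventually_elim
    case (elim T)
    obtain E where E: "E \<in> sets M" "emeasure M E < ennreal e"
      "\<forall>\<omega>\<in>space M - E. dist (X T \<omega>) 0 \<le> e / C" using elim(1) by auto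
    have "dist (Y T \<omega>) 0 \<le> e" if "\<omega> \<in> space M - E" for \<omega>
    proof -
      have "norm (Y T \<omega>) \<le> B * norm (X T \<omega>)" using elim(2) that by auto
      also have "\<dots> \<le> C * (e / C)" using E(3) that C by (intro mult_mono) auto
      finally show ?thesis using C by simp
    qed
    with E show ?case by auto
  qed
qed

text \<open>Values in \<open>ennreal\<close> avoid any discussion of integrability. Points where
  \<open>Z T\<close> is infinite, which \<open>enn2real\<close> would send to 0, fall into the
  exceptional set.\<close>

lemma conv_in_prob_Markov:
  assumes "\<And>T. Z T \<in> borel_measurable M" "(\<lambda>T. \<integral>\<^sup>+\<omega>. Z T \<omega> \<partial>M) \<longlonglongrightarrow> 0"
  shows "conv_in_prob M (\<lambda>T \<omega>. enn2real (Z T \<omega>)) 0"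
  unfolding conv_in_prob_iff
proof (intro allI impI)
  fix e :: real assume e: "e > 0"
  \<comment> \<open>Markov's inequality at level \<open>e\<close> divides the mean by
    \<open>e\<close>; starting from \<open>e * e\<close> leaves probability below
    \<open>e\<close>.\<close>
  have "\<forall>\<^sub>F T in sequentially. (\<integral>\<^sup>+\<omega>. Z T \<omega> \<partial>M) < ennreal (e * e)"
    using assms(2) by (rule order_tendstoD) (use e in auto)
  then show "\<forall>\<^sub>F T in sequentially. \<exists>E\<in>sets M. emeasure M E < ennreal e \<and>
        (\<forall>\<omega>\<in>space M - E. dist (enn2real (Z T \<omega>)) 0 \<le> e)"
  proof eventually_elim
    case (elim T)
    note [measurable] = assms(1)
    define E where "E = {\<omega>\<in>space M. 1 \<le> ennreal (1/e) * Z T \<omega>}"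
    have "E \<in> sets M" unfolding E_def by measurable
    have "emeasure M E = emeasure M ({\<omega>\<in>space M. 1 \<le> ennreal (1/e) * Z T \<omega>} \<inter> space M)"
      unfolding E_def by (rule arg_cong[of _ _ "emeasure M"]) auto
    also have "\<dots> \<le> ennreal (1/e) * (\<integral>\<^sup>+\<omega>. Z T \<omega> * indicator (space M) \<omega> \<partial>M)"
      using nn_integral_Markov_inequality[of "Z T" "space M" M "ennreal (1/e)"]
      by (simp add: Int_def conj_commute)
    also have "(\<integral>\<^sup>+\<omega>. Z T \<omega> * indicator (space M) \<omega> \<partial>M) = (\<integral>\<^sup>+\<omega>. Z T \<omega> \<partial>M)"
      by (intro nn_integral_cong) auto
    also have "ennreal (1/e) * (\<integral>\<^sup>+\<omega>. Z T \<omega> \<partial>M) < ennreal (1/e) * ennreal (e * e)"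
      using e by (intro ennreal_mult_strict_left_mono elim) auto
    also have "\<dots> = ennreal e" using e by (simp flip: ennreal_mult)
    finally have "emeasure M E < ennreal e" .
    moreover have "dist (enn2real (Z T \<omega>)) 0 \<le> e" if "\<omega> \<in> space M - E" for \<omega>
    proof -
      have "ennreal (1/e) * Z T \<omega> < 1" using that by (auto simp: E_def not_le)
      then have "ennreal e * (ennreal (1/e) * Z T \<omega>) \<le> ennreal e * 1"
        by (intro mult_left_mono) auto
      then have "Z T \<omega> \<le> ennreal e" using e by (simp flip: mult.assoc ennreal_mult)
      then show ?thesis using e by (simp add: enn2real_leI)
    qed
    ultimately show ?case using \<open>E \<in> sets M\<close> by auto
  qed
qed

text \<open>Bounded means make \<open>Q\<close> bounded in probability, and a term tending to 0 in
  probability stays so after multiplication by it. \<open>X\<close> need not be measurable.\<close>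

lemma conv_in_prob_mult_bounded:
  fixes X :: "nat \<Rightarrow> 'w \<Rightarrow> real"
  assumes "conv_in_prob M X 0" "\<And>T. Q T \<in> borel_measurable M"
    and bd: "\<And>T. (\<integral>\<^sup>+\<omega>. Q T \<omega> \<partial>M) \<le> ennreal C"
  shows "conv_in_prob M (\<lambda>T \<omega>. X T \<omega> * enn2real (Q T \<omega>)) 0"
  unfolding conv_in_prob_iff
proof (intro allI impI)
  fix e :: real assume e: "e > 0"
  note [measurable] = assms(2)
  \<comment> \<open>Chosen so that Markov's inequality gives \<open>Q T\<close> probability at most
    \<open>e/4\<close> of reaching \<open>B\<close>, strictly below the allowance
    \<open>e/2\<close>. \<open>\<bar>C\<bar> + 1\<close> keeps \<open>B\<close> positive whatever
    the sign of \<open>C\<close>.\<close>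
  define B where "B = 4 * (\<bar>C\<bar> + 1) / e"
  have B: "B > 0" using e by (auto simp: B_def)
  show "\<forall>\<^sub>F T in sequentially. \<exists>E\<in>sets M. emeasure M E < ennreal e \<and>
        (\<forall>\<omega>\<in>space M - E. dist (X T \<omega> * enn2real (Q T \<omega>)) 0 \<le> e)"
    using conv_in_probD[OF assms(1) divide_pos_pos[OF e B] half_gt_zero[OF e]]
  proof eventually_elim
    case (elim T)
    obtain E1 where E1: "E1 \<in> sets M" "emeasure M E1 < ennreal (e/2)"
      "\<forall>\<omega>\<in>space M - E1. dist (X T \<omega>) 0 \<le> e/B" using elim e by auto
    define E where "E = {\<omega>\<in>space M. 1 \<le> ennreal (1/B) * Q T \<omega>}"
    have E: "E \<in> sets M" unfolding E_def by measurable
    have "emeasure M E = emeasure M ({\<omega>\<in>space M. 1 \<le> ennreal (1/B) * Q T \<omega>} \<inter> space M)"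
      unfolding E_def by (rule arg_cong[of _ _ "emeasure M"]) auto
    also have "\<dots> \<le> ennreal (1/B) * (\<integral>\<^sup>+\<omega>. Q T \<omega> * indicator (space M) \<omega> \<partial>M)"
      using nn_integral_Markov_inequality[of "Q T" "space M" M "ennreal (1/B)"]
      by (simp add: Int_def conj_commute)
    also have "(\<integral>\<^sup>+\<omega>. Q T \<omega> * indicator (space M) \<omega> \<partial>M) = (\<integral>\<^sup>+\<omega>. Q T \<omega> \<partial>M)"
      by (intro nn_integral_cong) auto
    also have "ennreal (1/B) * (\<integral>\<^sup>+\<omega>. Q T \<omega> \<partial>M) \<le> ennreal (1/B) * ennreal (\<bar>C\<bar> + 1)"
      by (intro mult_left_mono order_trans[OF bd] ennreal_leI) auto
    also have "\<dots> = ennreal ((1/B) * (\<bar>C\<bar> + 1))" using B by (intro ennreal_mult[symmetric]) auto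
    also have "(1/B) * (\<bar>C\<bar> + 1) = e / 4" using e B
      by (auto simp: B_def field_simps abs_if split: if_splits)
    also have "ennreal (e/4) < ennreal (e/2)" using e by (intro ennreal_lessI) auto
    finally have "emeasure M E < ennreal (e/2)" .
    with E1 have "emeasure M E1 + emeasure M E < ennreal (e/2) + ennreal (e/2)"
      by (intro add_strict_mono) auto
    also have "\<dots> = ennreal e" using e by (simp flip: ennreal_plus)
    finally have "emeasure M (E1 \<union> E) < ennreal e"
      by (rule le_less_trans[OF emeasure_subadditive[OF E1(1) E]])
    moreover have "dist (X T \<omega> * enn2real (Q T \<omega>)) 0 \<le> e" if "\<omega> \<in> space M - (E1 \<union> E)" for \<omega>
    proof -
      have "ennreal (1/B) * Q T \<omega> < 1" using that by (auto simp: E_def not_le)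
      then have "ennreal B * (ennreal (1/B) * Q T \<omega>) \<le> ennreal B * 1"
        by (intro mult_left_mono) auto
      then have "Q T \<omega> \<le> ennreal B" using B by (simp flip: mult.assoc ennreal_mult)
      then have "enn2real (Q T \<omega>) \<le> B" using B by (simp add: enn2real_leI)
      moreover have "\<bar>X T \<omega>\<bar> \<le> e / B" using E1(3) that by auto
      ultimately have "\<bar>X T \<omega>\<bar> * enn2real (Q T \<omega>) \<le> (e / B) * B" 
        using e B by (intro mult_mono) auto
      then show ?thesis using B by (simp add: abs_mult)
    qed
    ultimately show ?case using E1(1) E by (intro bexI[of _ "E1 \<union> E"]) auto
  qed
qed

lemma conv_in_prob_deterministic:
  fixes c :: "nat \<Rightarrow> 'b :: metric_space"
  assumes "c \<longlonglongrightarrow> l"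
  shows "conv_in_prob M (\<lambda>T \<omega>. c T) l"
  unfolding conv_in_prob_iff
proof (intro allI impI)
  fix e :: real assume "e > 0"
  with assms have "\<forall>\<^sub>F T in sequentially. dist (c T) l < e" by (rule tendstoD)
  then show "\<forall>\<^sub>F T in sequentially. \<exists>E\<in>sets M. emeasure M E < ennreal e \<and>
        (\<forall>\<omega>\<in>space M - E. dist (c T) l \<le> e)"
    by eventually_elim (use \<open>e > 0\<close> in \<open>auto intro!: bexI[of _ "{}"]\<close>)
qed

lemma conv_in_prob_cmult:
  fixes X :: "nat \<Rightarrow> 'w \<Rightarrow> real"
  assumes "conv_in_prob M X 0"
  shows "conv_in_prob M (\<lambda>T \<omega>. c * X T \<omega>) 0"
  by (rule conv_in_prob_norm_le[OF assms, of _ "\<bar>c\<bar>"]) (simp add: abs_mult)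

subsection \<open>Averages of orthogonal sequences\<close>

lemma borel_measurable_vec_nth [measurable (raw)]:
  fixes f :: "'a \<Rightarrow> real ^ 'n"
  assumes "f \<in> borel_measurable M"
  shows "(\<lambda>x. f x $ i) \<in> borel_measurable M"
  using assms by (rule borel_measurable_continuous_on[rotated]) (intro continuous_intros)

text \<open>In the second moment of the average only the \<open>T\<close> diagonal terms survive,
  each at most \<open>C\<close>, against a factor \<open>1 / T\<close> squared. For
  \<open>T = 0\<close> both sides are 0 because division by zero gives 0.\<close>

lemma (in prob_space) nn_integral_abs_average_orthogonal:
  fixes Y :: "nat \<Rightarrow> 'a \<Rightarrow> real"
  assumes [measurable]: "\<And>t. Y t \<in> borel_measurable M"
    and int: "\<And>s t. integrable M (\<lambda>\<omega>. Y s \<omega> * Y t \<omega>)"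
    and orth: "\<And>s t. s < t \<Longrightarrow> expectation (\<lambda>\<omega>. Y s \<omega> * Y t \<omega>) = 0"
    and bound: "\<And>t. expectation (\<lambda>\<omega>. (Y t \<omega>)\<^sup>2) \<le> C" and "0 \<le> C"
  shows "(\<integral>\<^sup>+\<omega>. ennreal \<bar>(1 / real T) * (\<Sum>t=1..T. Y t \<omega>)\<bar> \<partial>M) \<le> ennreal (sqrt (C / real T))"
proof -
  define Z where "Z \<omega> = (1 / real T) * (\<Sum>t=1..T. Y t \<omega>)" for \<omega>
  have [measurable]: "Z \<in> borel_measurable M" unfolding Z_def by measurable
  have orth': "expectation (\<lambda>\<omega>. Y s \<omega> * Y t \<omega>) = 0" if "s \<noteq> t" for s t
    using that orth[of s t] orth[of t s] by (cases s t rule: linorder_cases) (auto simp: mult.commute)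
  have Z2: "(Z \<omega>)\<^sup>2 = (1 / (real T)\<^sup>2) * (\<Sum>s=1..T. \<Sum>t=1..T. Y s \<omega> * Y t \<omega>)" for \<omega>
    unfolding Z_def power_mult_distrib
    by (simp add: power2_eq_square sum_product)
  have Z2_int: "integrable M (\<lambda>\<omega>. (Z \<omega>)\<^sup>2)"
    unfolding Z2 by (intro integrable_mult_right Bochner_Integration.integrable_sum int)
  have "expectation (\<lambda>\<omega>. (Z \<omega>)\<^sup>2)
      = (1 / (real T)\<^sup>2) * (\<Sum>s=1..T. \<Sum>t=1..T. expectation (\<lambda>\<omega>. Y s \<omega> * Y t \<omega>))"
    unfolding Z2 by (simp add: Bochner_Integration.integral_sum int)
  also have "(\<Sum>s=1..T. \<Sum>t=1..T. expectation (\<lambda>\<omega>. Y s \<omega> * Y t \<omega>))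
      = (\<Sum>s=1..T. \<Sum>t=1..T. if t = s then expectation (\<lambda>\<omega>. (Y s \<omega>)\<^sup>2) else 0)"
    by (intro sum.cong refl) (auto simp: orth' power2_eq_square)
  also have "\<dots> = (\<Sum>s=1..T. expectation (\<lambda>\<omega>. (Y s \<omega>)\<^sup>2))"
    by (intro sum.cong refl) (simp add: sum.delta)
  also have "(1 / (real T)\<^sup>2) * \<dots> \<le> (1 / (real T)\<^sup>2) * (\<Sum>s=1..T. C)"
    by (intro mult_left_mono sum_mono bound) auto
  also have "\<dots> = C / real T" by (cases "T = 0") (auto simp: power2_eq_square)
  finally have E2: "expectation (\<lambda>\<omega>. (Z \<omega>)\<^sup>2) \<le> C / real T" .
  \<comment> \<open>This is the nonnegativity of the variance of
    \<open>\<bar>Z\<bar>\<close>.\<close>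
  have "(expectation (\<lambda>\<omega>. \<bar>Z \<omega>\<bar>))\<^sup>2 \<le> expectation (\<lambda>\<omega>. (Z \<omega>)\<^sup>2)"
  proof -
    have i: "integrable M (\<lambda>\<omega>. \<bar>Z \<omega>\<bar>)"
      using square_integrable_imp_integrable[OF _ Z2_int] by auto
    show ?thesis
      using variance_positive[of "\<lambda>\<omega>. \<bar>Z \<omega>\<bar>"] variance_eq[OF i] Z2_int by simp
  qed
  with E2 have "expectation (\<lambda>\<omega>. \<bar>Z \<omega>\<bar>) \<le> sqrt (C / real T)"
    by (intro real_le_rsqrt) simp
  moreover have "(\<integral>\<^sup>+\<omega>. ennreal \<bar>Z \<omega>\<bar> \<partial>M) = ennreal (expectation (\<lambda>\<omega>. \<bar>Z \<omega>\<bar>))"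
    using square_integrable_imp_integrable[OF _ Z2_int] by (intro nn_integral_eq_integral) auto
  ultimately show ?thesis unfolding Z_def by (simp add: ennreal_leI)
qed

lemma sqrt_const_over_nat_tendsto_0: "(\<lambda>T. ennreal (sqrt (C / real T))) \<longlonglongrightarrow> 0"
proof -
  have "(\<lambda>T. sqrt (C / real T)) \<longlonglongrightarrow> sqrt 0"
    by (intro tendsto_real_sqrt lim_const_over_n)
  then show ?thesis using tendsto_ennrealI by force
qed

lemma tendsto_0_ennreal_le:
  fixes f g :: "'b \<Rightarrow> ennreal"
  assumes "\<forall>\<^sub>F x in F. f x \<le> g x" "(g \<longlongrightarrow> 0) F"
  shows "(f \<longlongrightarrow> 0) F"
  using assms by (intro tendsto_sandwich[OF _ assms(1) tendsto_const assms(2)]) auto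

section \<open>Martingale differences, stationarity and consistency of the estimator\<close>

lemma space_sigma_of [simp]: "space (sigma_of M X I) = space M"
  unfolding sigma_of_def by (rule space_measure_of) auto

lemma sets_sigma_of:
  "sets (sigma_of M X I) = sigma_sets (space M) (\<Union>s\<in>I. {X s -` A \<inter> space M | A. A \<in> sets borel})"
  unfolding sigma_of_def by (rule sets_measure_of) auto

lemma subalgebra_sigma_of:
  assumes "\<And>s. s \<in> I \<Longrightarrow> X s \<in> borel_measurable M"
  shows "subalgebra M (sigma_of M X I)"
  unfolding subalgebra_def sets_sigma_of
  using assms by (auto intro!: sets.sigma_sets_subset dest: measurable_sets)

lemma sigma_of_mono: "I \<subseteq> J \<Longrightarrow> sets (sigma_of M X I) \<subseteq> sets (sigma_of M X J)"
  unfolding sets_sigma_of by (intro sigma_sets_mono') auto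

text \<open>For integers, \<open>s < t\<close> puts time \<open>s\<close> into the past up to
  \<open>t - 1\<close>. Hence the earlier factor can be pulled out of the conditional expectation
  given that past, and the conditional expectation of the later one vanishes.\<close>

lemma (in prob_space) martingale_differences_orthogonal:
  assumes \<epsilon>: "\<And>t. \<epsilon> t \<in> borel_measurable M"
    and m: "martingale_differences M (\<lambda>t. sigma_of M \<epsilon> {..t}) m"
    and m2: "\<And>t. integrable M (\<lambda>\<omega>. (m t \<omega> $ k)\<^sup>2)"
  shows "(\<lambda>\<omega>. m t \<omega> $ k) \<in> borel_measurable M"
    and "integrable M (\<lambda>\<omega>. m s \<omega> $ k * m t \<omega> $ k)"
    and "s < t \<Longrightarrow> expectation (\<lambda>\<omega>. m s \<omega> $ k * m t \<omega> $ k) = 0"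
proof -
  have [measurable]: "m t \<in> borel_measurable M" for t
    using m by (intro borel_measurable_integrable) (auto simp: martingale_differences_def)
  have comp [measurable]: "(\<lambda>\<omega>. m t \<omega> $ k) \<in> borel_measurable M" for t by measurable
  show "(\<lambda>\<omega>. m t \<omega> $ k) \<in> borel_measurable M" by (rule comp)
  have int: "integrable M (\<lambda>\<omega>. m s \<omega> $ k * m t \<omega> $ k)" for s t
  proof (rule Bochner_Integration.integrable_bound)
    show "integrable M (\<lambda>\<omega>. (m s \<omega> $ k)\<^sup>2 + (m t \<omega> $ k)\<^sup>2)"
      by (intro Bochner_Integration.integrable_add m2)
    have "\<bar>a * b\<bar> \<le> a\<^sup>2 + b\<^sup>2" for a b :: real
    proof -
      have "2 * \<bar>a * b\<bar> \<le> a\<^sup>2 + b\<^sup>2"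
        using sum_squares_bound[of "\<bar>a\<bar>" "\<bar>b\<bar>"] by (simp add: abs_mult)
      moreover have "0 \<le> \<bar>a * b\<bar>" by simp
      ultimately show ?thesis by linarith
    qed
    then show "AE \<omega> in M. norm (m s \<omega> $ k * m t \<omega> $ k) \<le> norm ((m s \<omega> $ k)\<^sup>2 + (m t \<omega> $ k)\<^sup>2)"
      by (intro AE_I2) (simp add: order_trans[OF _ abs_ge_self])
  qed simp
  show "integrable M (\<lambda>\<omega>. m s \<omega> $ k * m t \<omega> $ k)" by (rule int)
  assume "s < t"
  define F where "F = sigma_of M \<epsilon> {..t - 1}"
  interpret finite_measure_subalgebra M F
    unfolding F_def by unfold_locales (intro subalgebra_sigma_of \<epsilon>)
  have "m s \<in> borel_measurable (sigma_of M \<epsilon> {..s})"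
    using m by (auto simp: martingale_differences_def)
  then have ms: "m s \<in> borel_measurable F"
    unfolding F_def using sigma_of_mono[of "{..s}" "{..t - 1}" M \<epsilon>] \<open>s < t\<close>
    by (auto simp: measurable_def)
  have msk: "(\<lambda>\<omega>. m s \<omega> $ k) \<in> borel_measurable F"
    using ms by (rule measurable_compose) simp
  have eq: "expectation (\<lambda>\<omega>. m s \<omega> $ k * m t \<omega> $ k)
      = expectation (\<lambda>\<omega>. m s \<omega> $ k * real_cond_exp M F (\<lambda>\<omega>. m t \<omega> $ k) \<omega>)"
    by (rule real_cond_exp_intg(2)[OF int msk comp, symmetric])
  have "AE \<omega> in M. real_cond_exp M F (\<lambda>\<omega>. m t \<omega> $ k) \<omega> = 0"
    using m unfolding martingale_differences_def F_def by blast
  then have "expectation (\<lambda>\<omega>. m s \<omega> $ k * real_cond_exp M F (\<lambda>\<omega>. m t \<omega> $ k) \<omega>)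
      = expectation (\<lambda>\<omega>. 0)"
    by (intro integral_cong_AE) (auto elim: eventually_mono)
  then show "expectation (\<lambda>\<omega>. m s \<omega> $ k * m t \<omega> $ k) = 0" unfolding eq by simp
qed

text \<open>Stationarity is an equality of laws on the whole path space, so it shifts functionals of
  the infinite past as well as of a single coordinate. The gradient envelope depends on
  that.\<close>

lemma strictly_stationary_nn_integral:
  assumes X: "strictly_stationary M X"
    and f: "f \<in> borel_measurable (\<Pi>\<^sub>M t\<in>UNIV. borel)"
  shows "(\<integral>\<^sup>+\<omega>. f (\<lambda>t. X (t + h) \<omega>) \<partial>M) = (\<integral>\<^sup>+\<omega>. f (\<lambda>t. X t \<omega>) \<partial>M)"
proof -
  have [measurable]: "X t \<in> borel_measurable M" for t using X by (auto simp: strictly_stationary_def)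
  have P: "(\<lambda>\<omega> t. X (t + h) \<omega>) \<in> measurable M (\<Pi>\<^sub>M t\<in>UNIV. borel)" for h
    by (intro measurable_PiM_single') auto
  have "(\<integral>\<^sup>+\<omega>. f (\<lambda>t. X (t + h) \<omega>) \<partial>M)
      = (\<integral>\<^sup>+z. f z \<partial>distr M (\<Pi>\<^sub>M t\<in>UNIV. borel) (\<lambda>\<omega> t. X (t + h) \<omega>))" for h
    using nn_integral_distr[OF P, of f h] f by simp
  from this[of h] this[of 0] show ?thesis
    using X by (simp add: strictly_stationary_def)
qed

text \<open>Dividing the expansion by \<open>sqrt (real T)\<close> writes the estimation error as
  the average \<open>A\<close> of the differences plus a vanishing remainder. Stationarity makes the
  second moments of each coordinate constant in time, as the bound for orthogonal averages
  requires.\<close>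

lemma (in prob_space) estimator_consistent:
  fixes \<theta>hat :: "nat \<Rightarrow> 'a \<Rightarrow> real ^ 'k"
  assumes \<epsilon>: "\<And>t. \<epsilon> t \<in> borel_measurable M"
    and st: "strictly_stationary M m"
    and m: "martingale_differences M (\<lambda>t. sigma_of M \<epsilon> {..t}) m"
    and m2: "\<And>t k. integrable M (\<lambda>\<omega>. (m t \<omega> $ k)\<^sup>2)"
    and ex: "conv_in_prob M
      (\<lambda>T \<omega>. sqrt (real T) *\<^sub>R (\<theta>hat T \<omega> - \<theta>0)
              - (1 / sqrt (real T)) *\<^sub>R (\<Sum>t=1..T. m (int t) \<omega>)) 0"
  shows "conv_in_prob M (\<lambda>T \<omega>. \<theta>hat T \<omega> - \<theta>0) 0"
proof -
  define A where "A T \<omega> = (1 / real T) *\<^sub>R (\<Sum>t=1..T. m (int t) \<omega>)" for T \<omega>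
  define C where "C k = expectation (\<lambda>\<omega>. (m 0 \<omega> $ k)\<^sup>2)" for k
  have C0: "C k \<ge> 0" for k unfolding C_def by (intro integral_nonneg_AE) auto
  have Ceq: "expectation (\<lambda>\<omega>. (m t \<omega> $ k)\<^sup>2) = C k" for t k
  proof -
    have "(\<integral>\<^sup>+\<omega>. ennreal ((m t \<omega> $ k)\<^sup>2) \<partial>M) = (\<integral>\<^sup>+\<omega>. ennreal ((m 0 \<omega> $ k)\<^sup>2) \<partial>M)"
      using strictly_stationary_nn_integral[OF st, of "\<lambda>z. ennreal ((z 0 $ k)\<^sup>2)" t] by simp
    moreover have "(\<integral>\<^sup>+\<omega>. ennreal ((m t \<omega> $ k)\<^sup>2) \<partial>M) = ennreal (expectation (\<lambda>\<omega>. (m t \<omega> $ k)\<^sup>2))" for t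
      by (intro nn_integral_eq_integral m2) auto
    ultimately show ?thesis using C0 by (simp add: C_def)
  qed
  have [measurable]: "(\<lambda>\<omega>. m t \<omega> $ k) \<in> borel_measurable M" for t k
    using martingale_differences_orthogonal(1)[OF \<epsilon> m m2] .
  define Z where "Z T \<omega> = (\<Sum>k\<in>UNIV. ennreal \<bar>(1 / real T) * (\<Sum>t=1..T. m (int t) \<omega> $ k)\<bar>)" for T \<omega>
  have [measurable]: "Z T \<in> borel_measurable M" for T unfolding Z_def by measurable
  have "(\<integral>\<^sup>+\<omega>. ennreal \<bar>(1 / real T) * (\<Sum>t=1..T. m (int t) \<omega> $ k)\<bar> \<partial>M)
      \<le> ennreal (sqrt (C k / real T))" for T k
    using martingale_differences_orthogonal(2,3)[OF \<epsilon> m m2]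
    by (intro nn_integral_abs_average_orthogonal) (simp_all add: Ceq C0)
  then have "(\<integral>\<^sup>+\<omega>. Z T \<omega> \<partial>M) \<le> (\<Sum>k\<in>UNIV. ennreal (sqrt (C k / real T)))" for T
    unfolding Z_def by (subst nn_integral_sum) (auto intro!: sum_mono simp del: sum_ennreal)
  moreover have "(\<lambda>T. \<Sum>k\<in>UNIV. ennreal (sqrt (C k / real T))) \<longlonglongrightarrow> (\<Sum>k\<in>(UNIV::'k set). 0)"
    by (intro tendsto_sum sqrt_const_over_nat_tendsto_0)
  ultimately have "(\<lambda>T. \<integral>\<^sup>+\<omega>. Z T \<omega> \<partial>M) \<longlonglongrightarrow> 0"
    unfolding sum.neutral_const by (rule tendsto_0_ennreal_le[OF always_eventually[OF allI]])
  then have Z: "conv_in_prob M (\<lambda>T \<omega>. enn2real (Z T \<omega>)) 0"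
    by (intro conv_in_prob_Markov) auto
  have A: "conv_in_prob M A 0"
  proof (rule conv_in_prob_norm_le[OF Z, of _ 1], intro always_eventually allI ballI)
    fix T \<omega>
    have "norm (A T \<omega>) \<le> (\<Sum>k\<in>UNIV. \<bar>A T \<omega> $ k\<bar>)" by (rule norm_le_l1_cart)
    also have "\<dots> = enn2real (Z T \<omega>)"
      unfolding Z_def A_def by (subst sum_ennreal) (auto simp: sum_nonneg)
    finally show "norm (A T \<omega>) \<le> 1 * norm (enn2real (Z T \<omega>))" by simp
  qed
  define R where "R T \<omega> = sqrt (real T) *\<^sub>R (\<theta>hat T \<omega> - \<theta>0)
              - (1 / sqrt (real T)) *\<^sub>R (\<Sum>t=1..T. m (int t) \<omega>)" for T \<omega>
  have R: "conv_in_prob M (\<lambda>T \<omega>. (1 / sqrt (real T)) *\<^sub>R R T \<omega>) 0"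
  proof (rule conv_in_prob_norm_le[of M R _ 1])
    show "conv_in_prob M R 0" using ex unfolding R_def .
    show "\<forall>\<^sub>F T in sequentially. \<forall>\<omega>\<in>space M.
        norm ((1 / sqrt (real T)) *\<^sub>R R T \<omega>) \<le> 1 * norm (R T \<omega>)"
      using eventually_ge_at_top[of 1]
    proof eventually_elim
      case (elim T)
      \<comment> \<open>The remainder already tends to 0, so its additional factor only has to be
        bounded.\<close>
      then have "1 / sqrt (real T) \<le> 1" by simp
      then have "1 / sqrt (real T) * norm (R T \<omega>) \<le> 1 * norm (R T \<omega>)" for \<omega>
        by (rule mult_right_mono) simp
      then show ?case by simp
    qed
  qed
  have "conv_in_prob M (\<lambda>T \<omega>. (1 / sqrt (real T)) *\<^sub>R R T \<omega> + A T \<omega>) (0 + 0)"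
    by (intro conv_in_prob_add R A)
  then have S: "conv_in_prob M (\<lambda>T \<omega>. (1 / sqrt (real T)) *\<^sub>R R T \<omega> + A T \<omega>) 0" by simp
  show ?thesis
  proof (rule conv_in_prob_norm_le[OF S, of _ 1])
    show "\<forall>\<^sub>F T in sequentially. \<forall>\<omega>\<in>space M. norm (\<theta>hat T \<omega> - \<theta>0)
        \<le> 1 * norm ((1 / sqrt (real T)) *\<^sub>R R T \<omega> + A T \<omega>)"
      using eventually_ge_at_top[of 1]
    proof eventually_elim
      case (elim T)
      then have "(1 / sqrt (real T)) *\<^sub>R R T \<omega> + A T \<omega> = \<theta>hat T \<omega> - \<theta>0" for \<omega>
        unfolding R_def A_def by (simp add: scaleR_diff_right flip: real_sqrt_mult)
      then show ?case by simp
    qed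
  qed
qed

section \<open>The empirical Laplace transform of the innovations at a fixed point\<close>

lemma sets_pos_orthant [measurable]: "(pos_orthant :: (real ^ 'd) set) \<in> sets borel"
proof -
  have "{u :: real ^ 'd. \<forall>j. 0 < u $ j} \<in> sets borel" by measurable
  then show ?thesis by (simp add: pos_orthant_def)
qed

lemma inner_nonneg_vec:
  fixes u y :: "real ^ 'd"
  assumes "u \<in> pos_orthant" "0 \<le> y"
  shows "0 \<le> u \<bullet> y"
  using assms by (auto simp: inner_vec_def pos_orthant_def less_eq_vec_def less_imp_le intro!: sum_nonneg)

text \<open>The centred variables are differences of numbers in \<open>[0, 1]\<close>, hence almost
  surely bounded by 1, and independence makes them orthogonal. The bound does not depend on
  \<open>u\<close>, which allows integration against the weight.\<close>

lemma (in prob_space) nn_integral_empirical_laplace: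
  fixes \<epsilon> :: "int \<Rightarrow> 'a \<Rightarrow> real ^ 'd"
  assumes ind: "indep_vars (\<lambda>_. borel) \<epsilon> UNIV"
    and law: "\<And>t. distr M borel (\<epsilon> t) = F"
    and nonneg: "AE y in F. 0 \<le> y"
    and u: "u \<in> pos_orthant" and T: "0 < T"
  shows "(\<integral>\<^sup>+\<omega>. ennreal \<bar>emp_laplace (\<lambda>t. \<epsilon> (int t) \<omega>) T u
            - expectation (\<lambda>\<omega>. exp (- (u \<bullet> \<epsilon> 1 \<omega>)))\<bar> \<partial>M) \<le> ennreal (sqrt (1 / real T))"
proof -
  have [measurable]: "\<epsilon> t \<in> borel_measurable M" for t using ind by (auto simp: indep_vars_def)
  define a where "a = expectation (\<lambda>\<omega>. exp (- (u \<bullet> \<epsilon> 1 \<omega>)))"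
  define f :: "real ^ 'd \<Rightarrow> real" where "f y = exp (- (u \<bullet> y))" for y
  have f: "f \<in> borel_measurable borel" unfolding f_def by measurable
  have eps_nn: "AE \<omega> in M. 0 \<le> \<epsilon> t \<omega>" for t
    using nonneg unfolding law[of t, symmetric] by (subst (asm) AE_distr_iff) auto
  have bd: "AE \<omega> in M. norm (f (\<epsilon> t \<omega>)) \<le> 1" for t
    using eps_nn[of t] by eventually_elim (simp add: f_def inner_nonneg_vec[OF u])
  have int: "integrable M (\<lambda>\<omega>. f (\<epsilon> t \<omega>))" for t
    by (rule integrable_const_bound[OF bd]) (auto simp: f_def)
  have ea: "expectation (\<lambda>\<omega>. f (\<epsilon> t \<omega>)) = a" for t
  proof -
    have "expectation (\<lambda>\<omega>. f (\<epsilon> t \<omega>)) = (\<integral>y. f y \<partial>F)" for t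
      unfolding law[of t, symmetric] by (rule integral_distr[symmetric]) (auto simp: f)
    from this[of t] this[of 1] show ?thesis by (simp add: a_def f_def)
  qed
  have a: "0 \<le> a" "a \<le> 1"
  proof -
    show "0 \<le> a" unfolding a_def by (intro integral_nonneg_AE) auto
    have "expectation (\<lambda>\<omega>. f (\<epsilon> 1 \<omega>)) \<le> expectation (\<lambda>\<omega>. 1)"
      using bd[of 1] by (intro integral_mono_AE int) auto
    then show "a \<le> 1" using ea by (simp add: prob_space)
  qed
  define Y where "Y t \<omega> = f (\<epsilon> (int t) \<omega>) - a" for t \<omega>
  have [measurable]: "Y t \<in> borel_measurable M" for t unfolding Y_def f_def by measurable
  have Ybd: "AE \<omega> in M. norm (Y t \<omega>) \<le> 1" for t
    using bd[of "int t"]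
  proof eventually_elim
    case (elim \<omega>)
    moreover have "0 < f (\<epsilon> (int t) \<omega>)" by (simp add: f_def)
    ultimately show ?case using a unfolding Y_def real_norm_def by linarith
  qed
  have YYbd: "AE \<omega> in M. norm (Y s \<omega> * Y t \<omega>) \<le> 1" for s t
    using Ybd[of s] Ybd[of t] by eventually_elim (simp add: abs_mult mult_le_one)
  have Yint: "integrable M (Y t)" for t
    by (rule integrable_const_bound[OF Ybd]) auto
  have YYint: "integrable M (\<lambda>\<omega>. Y s \<omega> * Y t \<omega>)" for s t
    by (rule integrable_const_bound[OF YYbd]) auto
  have Y0: "expectation (Y t) = 0" for t
    unfolding Y_def using int by (simp add: ea prob_space)
  have orth: "expectation (\<lambda>\<omega>. Y s \<omega> * Y t \<omega>) = 0" if "s < t" for s t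
  proof -
    have "indep_vars (\<lambda>_. borel) (\<lambda>i \<omega>. f (\<epsilon> i \<omega>) - a) UNIV"
      by (rule indep_vars_compose2[OF ind]) (auto intro!: borel_measurable_diff f)
    then have "indep_vars (\<lambda>_. borel) (\<lambda>i \<omega>. f (\<epsilon> i \<omega>) - a) {int s, int t}"
      by (rule indep_vars_subset) auto
    then have "expectation (\<lambda>\<omega>. \<Prod>i\<in>{int s, int t}. f (\<epsilon> i \<omega>) - a)
        = (\<Prod>i\<in>{int s, int t}. expectation (\<lambda>\<omega>. f (\<epsilon> i \<omega>) - a))"
      using int by (intro indep_vars_lebesgue_integral) auto
    then show ?thesis using that Y0[unfolded Y_def] by (simp add: Y_def)
  qed
  have sq: "expectation (\<lambda>\<omega>. (Y t \<omega>)\<^sup>2) \<le> 1" for t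
  proof -
    have "expectation (\<lambda>\<omega>. (Y t \<omega>)\<^sup>2) \<le> expectation (\<lambda>\<omega>. 1)"
      using YYbd[of t t] YYint[of t t]
      by (intro integral_mono_AE) (auto simp: power2_eq_square elim: eventually_mono)
    then show ?thesis by (simp add: prob_space)
  qed
  \<comment> \<open>Here \<open>T > 0\<close> matters: the average of the constant \<open>a\<close>
    would be 0 for \<open>T = 0\<close>.\<close>
  have "emp_laplace (\<lambda>t. \<epsilon> (int t) \<omega>) T u - a = (1 / real T) * (\<Sum>t=1..T. Y t \<omega>)" for \<omega>
    using T by (simp add: emp_laplace_def Y_def f_def sum_subtractf field_simps)
  then show ?thesis
    using nn_integral_abs_average_orthogonal[OF _ YYint orth sq] by (simp add: a_def)
qed

subsection \<open>Laplace transforms\<close>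

lemma laplace_bounds:
  assumes "prob_space D" "sets D = sets borel" "u \<in> pos_orthant"
  shows "0 \<le> laplace D u" "laplace D u \<le> 1"
proof -
  interpret prob_space D by fact
  have le: "indicator pos_orthant y *\<^sub>R exp (- (u \<bullet> y)) \<le> (1::real)" for y
  proof (cases "y \<in> pos_orthant")
    case True
    then have "0 \<le> y" by (auto simp: pos_orthant_def less_eq_vec_def less_imp_le)
    then show ?thesis using inner_nonneg_vec[OF assms(3)] True by simp
  qed simp
  show "0 \<le> laplace D u"
    unfolding laplace_def set_lebesgue_integral_def by (intro integral_nonneg_AE) auto
  have "laplace D u \<le> (\<integral>y. 1 \<partial>D)"
    unfolding laplace_def set_lebesgue_integral_def
  proof (rule integral_mono')
    show "integrable D (\<lambda>y. 1 :: real)" by simp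
  qed (use le in auto)
  then show "laplace D u \<le> 1" by (simp add: prob_space)
qed

lemma borel_measurable_laplace [measurable]:
  assumes "prob_space D" "sets D = sets borel"
  shows "laplace D \<in> borel_measurable borel"
proof -
  interpret prob_space D by fact
  note [measurable_cong] = assms(2)
  have "(\<lambda>u. \<integral>y. indicator pos_orthant y *\<^sub>R exp (- (u \<bullet> y)) \<partial>D) \<in> borel_measurable borel"
    by measurable
  then show ?thesis by (simp add: laplace_def set_lebesgue_integral_def[abs_def] cong: measurable_cong)
qed

lemma emp_laplace_bounds:
  assumes "\<And>t. t \<in> {1..T} \<Longrightarrow> 0 \<le> e t" "u \<in> pos_orthant"
  shows "0 \<le> emp_laplace e T u" "emp_laplace e T u \<le> 1"
proof -
  show "0 \<le> emp_laplace e T u" by (auto simp: emp_laplace_def intro!: sum_nonneg divide_nonneg_nonneg)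
  have "(\<Sum>t=1..T. exp (- (u \<bullet> e t))) \<le> (\<Sum>t=1..T. 1)"
    using inner_nonneg_vec[OF assms(2)] assms(1) by (intro sum_mono) auto
  then show "emp_laplace e T u \<le> 1"
    by (cases "T = 0") (auto simp: emp_laplace_def divide_simps)
qed

lemma abs_exp_minus_diff_le:
  fixes a b :: real
  assumes "0 \<le> a" "0 \<le> b"
  shows "\<bar>exp (- a) - exp (- b)\<bar> \<le> \<bar>a - b\<bar>"
proof -
  have *: "exp (- a) - exp (- b) \<le> b - a" if "0 \<le> a" "a \<le> b" for a b :: real
  proof -
    have "exp (- a) - exp (- b) = exp (- a) * (1 - exp (- (b - a)))"
      by (simp add: right_diff_distrib flip: exp_add)
    also have "\<dots> \<le> 1 * (b - a)"
    proof (rule mult_mono)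
      show "1 - exp (- (b - a)) \<le> b - a" using exp_ge_add_one_self[of "- (b - a)"] by linarith
    qed (use that in auto)
    finally show ?thesis by simp
  qed
  show ?thesis using *[of a b] *[of b a] assms by (cases "a \<le> b") auto
qed

lemma (in prob_space) tendsto_integrated_empirical_laplace:
  fixes \<epsilon> :: "int \<Rightarrow> 'a \<Rightarrow> real ^ 'd" and w :: "real ^ 'd \<Rightarrow> real"
  assumes ind: "indep_vars (\<lambda>_. borel) \<epsilon> UNIV"
    and law: "\<And>t. distr M borel (\<epsilon> t) = F"
    and nonneg: "AE y in F. 0 \<le> y"
    and w: "integrable lborel w" "\<And>u. 0 \<le> w u" "\<And>u. u \<notin> pos_orthant \<Longrightarrow> w u = 0"
  defines "a \<equiv> \<lambda>u. expectation (\<lambda>\<omega>. exp (- (u \<bullet> \<epsilon> 1 \<omega>)))"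
  defines "N \<equiv> \<lambda>T \<omega>. \<integral>\<^sup>+u. ennreal (\<bar>emp_laplace (\<lambda>t. \<epsilon> (int t) \<omega>) T u - a u\<bar> * w u) \<partial>lborel"
  shows "N T \<in> borel_measurable M" "(\<lambda>T. \<integral>\<^sup>+\<omega>. N T \<omega> \<partial>M) \<longlonglongrightarrow> 0"
proof -
  have \<epsilon> [measurable]: "\<epsilon> t \<in> borel_measurable M" for t using ind by (auto simp: indep_vars_def)
  have [measurable]: "w \<in> borel_measurable lborel" using w(1) by auto
  have [measurable]: "a \<in> borel_measurable borel" unfolding a_def by measurable
  have joint [measurable]: "(\<lambda>(\<omega>, u). ennreal (\<bar>emp_laplace (\<lambda>t. \<epsilon> (int t) \<omega>) T u - a u\<bar> * w u))
      \<in> borel_measurable (M \<Otimes>\<^sub>M lborel)" for T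
    unfolding emp_laplace_def by measurable
  show "N T \<in> borel_measurable M" for T
    unfolding N_def using lborel.borel_measurable_nn_integral[OF joint] by simp
  interpret pair_sigma_finite M lborel ..
  define I where "I = (\<integral>\<^sup>+u. ennreal (w u) \<partial>lborel)"
  have I: "I < \<infinity>" using w by (simp add: I_def integrable_iff_bounded)
  have bound: "(\<integral>\<^sup>+\<omega>. N T \<omega> \<partial>M) \<le> ennreal (sqrt (1 / real T)) * I" if "0 < T" for T
  proof -
    have "(\<integral>\<^sup>+\<omega>. N T \<omega> \<partial>M) = (\<integral>\<^sup>+u. \<integral>\<^sup>+\<omega>.
        ennreal (\<bar>emp_laplace (\<lambda>t. \<epsilon> (int t) \<omega>) T u - a u\<bar> * w u) \<partial>M \<partial>lborel)"
      unfolding N_def using Fubini'[OF joint, of T] by simp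
    also have "\<dots> \<le> (\<integral>\<^sup>+u. ennreal (sqrt (1 / real T)) * ennreal (w u) \<partial>lborel)"
    proof (intro nn_integral_mono)
      fix u :: "real ^ 'd"
      show "(\<integral>\<^sup>+\<omega>. ennreal (\<bar>emp_laplace (\<lambda>t. \<epsilon> (int t) \<omega>) T u - a u\<bar> * w u) \<partial>M)
          \<le> ennreal (sqrt (1 / real T)) * ennreal (w u)"
      proof (cases "u \<in> pos_orthant")
        case True
        have "(\<integral>\<^sup>+\<omega>. ennreal (\<bar>emp_laplace (\<lambda>t. \<epsilon> (int t) \<omega>) T u - a u\<bar> * w u) \<partial>M)
            = (\<integral>\<^sup>+\<omega>. ennreal \<bar>emp_laplace (\<lambda>t. \<epsilon> (int t) \<omega>) T u - a u\<bar> \<partial>M) * ennreal (w u)"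
          using w(2) by (subst nn_integral_multc[symmetric]) (auto simp: ennreal_mult emp_laplace_def)
        also have "\<dots> \<le> ennreal (sqrt (1 / real T)) * ennreal (w u)"
          unfolding a_def
          by (intro mult_right_mono nn_integral_empirical_laplace[OF ind law nonneg True that]) auto
        finally show ?thesis .
      qed (simp add: w(3))
    qed
    also have "\<dots> = ennreal (sqrt (1 / real T)) * I"
      unfolding I_def by (rule nn_integral_cmult) measurable
    finally show ?thesis .
  qed
  have "(\<lambda>T. ennreal (sqrt (1 / real T)) * I) \<longlonglongrightarrow> 0 * I"
    using I by (intro tendsto_mult_ennreal sqrt_const_over_nat_tendsto_0 tendsto_const) auto
  then have "(\<lambda>T. ennreal (sqrt (1 / real T)) * I) \<longlonglongrightarrow> 0" by simp
  then show "(\<lambda>T. \<integral>\<^sup>+\<omega>. N T \<omega> \<partial>M) \<longlonglongrightarrow> 0"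
    by (rule tendsto_0_ennreal_le[rotated])
      (rule eventually_mono[OF eventually_gt_at_top[of 0]], rule bound)
qed

text \<open>Deterministic core of the comparison. \<open>A\<close>, \<open>L\<close> and
  \<open>a\<close> are meant as the transforms of the residuals, of the observed innovations and of
  the innovation law; \<open>B\<close> and \<open>b\<close> as the fitted transform and its limit.
  The distance from \<open>L\<close> to \<open>a\<close> stays inside an integral, since it is
  controlled only in weighted mean and not uniformly in \<open>u\<close>.\<close>

lemma weighted_square_distance_bound:
  fixes A L a B b w :: "real ^ 'd \<Rightarrow> real"
  assumes [measurable]: "A \<in> borel_measurable borel" "L \<in> borel_measurable borel"
      "a \<in> borel_measurable borel" "B \<in> borel_measurable borel" "b \<in> borel_measurable borel"
    and w: "integrable lborel w" "integrable lborel (\<lambda>u. norm u * w u)"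
      "\<And>u. 0 \<le> w u" "\<And>u. u \<notin> pos_orthant \<Longrightarrow> w u = 0"
    and unit: "\<And>u. u \<in> pos_orthant \<Longrightarrow>
      A u \<in> {0..1} \<and> L u \<in> {0..1} \<and> a u \<in> {0..1} \<and> B u \<in> {0..1} \<and> b u \<in> {0..1}"
    and AL: "\<And>u. u \<in> pos_orthant \<Longrightarrow> \<bar>A u - L u\<bar> \<le> p + norm u * q"
    and Bb: "\<And>u. u \<in> pos_orthant \<Longrightarrow> \<bar>B u - b u\<bar> \<le> s"
  shows "\<bar>(\<integral>u. (A u - B u)\<^sup>2 * w u \<partial>lborel) - (\<integral>u. (a u - b u)\<^sup>2 * w u \<partial>lborel)\<bar>
     \<le> 2 * (p * (\<integral>u. w u \<partial>lborel) + q * (\<integral>u. norm u * w u \<partial>lborel)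
          + (\<integral>u. \<bar>L u - a u\<bar> * w u \<partial>lborel) + s * (\<integral>u. w u \<partial>lborel))"
proof -
  have [measurable]: "w \<in> borel_measurable borel" using w(1) by auto
  have int: "integrable lborel (\<lambda>u. f u * w u)"
    if [measurable]: "f \<in> borel_measurable borel" and f: "\<And>u. u \<in> pos_orthant \<Longrightarrow> \<bar>f u\<bar> \<le> 1" for f
  proof (rule Bochner_Integration.integrable_bound[OF w(1)])
    have "\<bar>f u * w u\<bar> \<le> \<bar>w u\<bar>" for u
    proof (cases "u \<in> pos_orthant")
      case True
      then show ?thesis using mult_right_mono[OF f[OF True], of "\<bar>w u\<bar>"] by (simp add: abs_mult)
    qed (simp add: w(4))
    then show "AE u in lborel. norm (f u * w u) \<le> norm (w u)" by auto
  qed measurable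
  have sq1: "\<bar>(x - y)\<^sup>2\<bar> \<le> 1" if "x \<in> {0..1}" "y \<in> {0..1}" for x y :: real
  proof -
    have "\<bar>x - y\<bar> \<le> 1" using that by auto
    then show ?thesis using power_le_one[of "\<bar>x - y\<bar>" 2] by simp
  qed
  have i1: "integrable lborel (\<lambda>u. (A u - B u)\<^sup>2 * w u)"
    and i2: "integrable lborel (\<lambda>u. (a u - b u)\<^sup>2 * w u)"
    using unit by (auto intro!: int sq1)
  have i3: "integrable lborel (\<lambda>u. \<bar>L u - a u\<bar> * w u)"
    using unit by (intro int) (fastforce simp: abs_le_iff)+
  have ineq: "\<bar>(A u - B u)\<^sup>2 * w u - (a u - b u)\<^sup>2 * w u\<bar>
      \<le> 2 * (p * w u + q * (norm u * w u) + \<bar>L u - a u\<bar> * w u + s * w u)" for u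
  proof (cases "u \<in> pos_orthant")
    case True
    note un = unit[OF True]
    \<comment> \<open>Factor a difference of squares: the first factor is a sum of two differences
      of numbers in \<open>[0, 1]\<close>, whence the constant 2.\<close>
    have "(A u - B u)\<^sup>2 - (a u - b u)\<^sup>2 = (A u - B u + (a u - b u)) * ((A u - a u) - (B u - b u))"
      by (simp add: power2_eq_square algebra_simps)
    then have "\<bar>(A u - B u)\<^sup>2 - (a u - b u)\<^sup>2\<bar>
        = \<bar>A u - B u + (a u - b u)\<bar> * \<bar>(A u - a u) - (B u - b u)\<bar>"
      by (simp add: abs_mult)
    also have "\<dots> \<le> 2 * (p + norm u * q + \<bar>L u - a u\<bar> + s)"
    proof (intro mult_mono)
      show "\<bar>A u - B u + (a u - b u)\<bar> \<le> 2" using un by auto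
      show "\<bar>(A u - a u) - (B u - b u)\<bar> \<le> p + norm u * q + \<bar>L u - a u\<bar> + s"
        using AL[OF True] Bb[OF True] by linarith
    qed auto
    finally have "\<bar>(A u - B u)\<^sup>2 - (a u - b u)\<^sup>2\<bar> * w u
        \<le> 2 * (p + norm u * q + \<bar>L u - a u\<bar> + s) * w u"
      by (intro mult_right_mono w(3))
    moreover have "\<bar>(A u - B u)\<^sup>2 * w u - (a u - b u)\<^sup>2 * w u\<bar> = \<bar>(A u - B u)\<^sup>2 - (a u - b u)\<^sup>2\<bar> * w u"
      using w(3)[of u] by (simp add: abs_mult flip: left_diff_distrib)
    ultimately show ?thesis by (simp add: algebra_simps)
  qed (simp add: w(4))
  have "\<bar>(\<integral>u. (A u - B u)\<^sup>2 * w u \<partial>lborel) - (\<integral>u. (a u - b u)\<^sup>2 * w u \<partial>lborel)\<bar>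
      = \<bar>\<integral>u. (A u - B u)\<^sup>2 * w u - (a u - b u)\<^sup>2 * w u \<partial>lborel\<bar>"
    using i1 i2 by simp
  also have "\<dots> \<le> (\<integral>u. \<bar>(A u - B u)\<^sup>2 * w u - (a u - b u)\<^sup>2 * w u\<bar> \<partial>lborel)"
    by (rule integral_abs_bound)
  also have "\<dots> \<le> (\<integral>u. 2 * (p * w u + q * (norm u * w u) + \<bar>L u - a u\<bar> * w u + s * w u) \<partial>lborel)"
    using i1 i2 i3 w(1,2) ineq by (intro integral_mono) auto
  also have "\<dots> = 2 * (p * (\<integral>u. w u \<partial>lborel) + q * (\<integral>u. norm u * w u \<partial>lborel)
          + (\<integral>u. \<bar>L u - a u\<bar> * w u \<partial>lborel) + s * (\<integral>u. w u \<partial>lborel))"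
    using i3 w(1,2) by simp
  finally show ?thesis .
qed

text \<open>The summand for \<open>t = 1\<close> is only bounded by 1, since its conditional mean is computed from initial
  values alone and nothing relates it to \<open>\<nu> 1\<close>.\<close>

lemma emp_laplace_residuals_bound:
  fixes e x \<nu> \<nu>h :: "nat \<Rightarrow> real ^ 'd"
  assumes T: "0 < T" and u: "u \<in> pos_orthant" and c: "0 < c"
    and x: "\<And>t. t \<in> {1..T} \<Longrightarrow> 0 \<le> x t" "\<And>t. t \<in> {1..T} \<Longrightarrow> x t = \<nu> t * e t"
    and e: "\<And>t. t \<in> {1..T} \<Longrightarrow> 0 \<le> e t"
    and lower: "\<And>t j. t \<in> {1..T} \<Longrightarrow> c \<le> \<nu> t $ j" "\<And>t j. t \<in> {1..T} \<Longrightarrow> c \<le> \<nu>h t $ j"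
    and b: "\<And>t j. t \<in> {2..T} \<Longrightarrow> norm (x t) * \<bar>\<nu>h t $ j - \<nu> t $ j\<bar> \<le> b t"
    and b0: "\<And>t. 0 \<le> b t"
  shows "\<bar>emp_laplace (\<lambda>t. x t \<oslash> \<nu>h t) T u - emp_laplace e T u\<bar>
     \<le> 1 / real T + norm u * (real CARD('d) / c\<^sup>2 * ((\<Sum>t=1..T. b t) / real T))"
proof -
  define D where "D = real CARD('d) / c\<^sup>2"
  have eh: "0 \<le> x t \<oslash> \<nu>h t" if "t \<in> {1..T}" for t
    unfolding less_eq_vec_def vec_div_def
  proof
    fix j
    have "0 \<le> x t $ j" using x(1)[OF that] by (simp add: less_eq_vec_def)
    moreover have "0 < \<nu>h t $ j" using lower(2)[OF that, of j] c by linarith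
    ultimately show "0 $ j \<le> (\<chi> j. x t $ j / \<nu>h t $ j) $ j" by simp
  qed
  let ?d = "\<lambda>t. \<bar>exp (- (u \<bullet> (x t \<oslash> \<nu>h t))) - exp (- (u \<bullet> e t))\<bar>"
  have d1: "?d t \<le> 1" if "t \<in> {1..T}" for t
    using inner_nonneg_vec[OF u eh[OF that]] inner_nonneg_vec[OF u e[OF that]]
      exp_gt_zero[of "- (u \<bullet> (x t \<oslash> \<nu>h t))"] exp_gt_zero[of "- (u \<bullet> e t)"]
      one_le_exp_iff[of "u \<bullet> e t"]
      exp_le_one_iff[of "- (u \<bullet> (x t \<oslash> \<nu>h t))"] exp_le_one_iff[of "- (u \<bullet> e t)"]
    by linarith
  have d2: "?d t \<le> norm u * (D * b t)" if t: "t \<in> {2..T}" for t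
  proof -
    have t1: "t \<in> {1..T}" using t by auto
    have comp: "\<bar>(x t \<oslash> \<nu>h t - e t) $ j\<bar> \<le> b t / c\<^sup>2" for j
    proof -
      have pos: "0 < \<nu> t $ j" "0 < \<nu>h t $ j"
        using lower(1)[OF t1, of j] lower(2)[OF t1, of j] c by linarith+
      have "x t $ j = \<nu> t $ j * e t $ j" using x(2)[OF t1] by simp
      \<comment> \<open>Since \<open>e t\<close> is \<open>x t\<close> divided by
        \<open>\<nu> t\<close>, the error is a difference of two quotients with the same numerator;
        the common denominator is at least \<open>c\<^sup>2\<close>.\<close>
      then have "(x t \<oslash> \<nu>h t - e t) $ j = - (x t $ j * (\<nu>h t $ j - \<nu> t $ j) / (\<nu> t $ j * \<nu>h t $ j))"
        using pos by (simp add: vec_div_def field_simps)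
      then have "\<bar>(x t \<oslash> \<nu>h t - e t) $ j\<bar> = \<bar>x t $ j\<bar> * \<bar>\<nu>h t $ j - \<nu> t $ j\<bar> / (\<nu> t $ j * \<nu>h t $ j)"
        using pos by (simp add: abs_mult)
      also have "\<dots> \<le> b t / c\<^sup>2"
      proof (rule frac_le)
        show "\<bar>x t $ j\<bar> * \<bar>\<nu>h t $ j - \<nu> t $ j\<bar> \<le> b t"
          by (rule order_trans[OF mult_right_mono[OF component_le_norm_cart] b[OF t]]) simp
        show "c\<^sup>2 \<le> \<nu> t $ j * \<nu>h t $ j"
          unfolding power2_eq_square using lower(1)[OF t1, of j] lower(2)[OF t1, of j] c pos
          by (intro mult_mono) auto
      qed (use b0 c in auto)
      finally show ?thesis .
    qed
    have "?d t \<le> \<bar>u \<bullet> (x t \<oslash> \<nu>h t) - u \<bullet> e t\<bar>"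
      by (rule abs_exp_minus_diff_le[OF inner_nonneg_vec[OF u eh[OF t1]] inner_nonneg_vec[OF u e[OF t1]]])
    also have "\<dots> = \<bar>u \<bullet> (x t \<oslash> \<nu>h t - e t)\<bar>" by (simp add: inner_diff_right)
    also have "\<dots> \<le> norm u * norm (x t \<oslash> \<nu>h t - e t)" by (rule Cauchy_Schwarz_ineq2)
    also have "\<dots> \<le> norm u * (\<Sum>j\<in>UNIV. \<bar>(x t \<oslash> \<nu>h t - e t) $ j\<bar>)"
      by (intro mult_left_mono norm_le_l1_cart) auto
    also have "\<dots> \<le> norm u * (\<Sum>j\<in>(UNIV :: 'd set). b t / c\<^sup>2)"
      by (intro mult_left_mono sum_mono comp) auto
    finally show ?thesis by (simp add: D_def)
  qed
  have "\<bar>emp_laplace (\<lambda>t. x t \<oslash> \<nu>h t) T u - emp_laplace e T u\<bar>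
      = \<bar>\<Sum>t=1..T. exp (- (u \<bullet> (x t \<oslash> \<nu>h t))) - exp (- (u \<bullet> e t))\<bar> / real T"
    by (simp add: emp_laplace_def sum_subtractf flip: diff_divide_distrib)
  also have "\<dots> \<le> (\<Sum>t=1..T. ?d t) / real T"
    by (intro divide_right_mono sum_abs) auto
  also have "\<dots> \<le> (\<Sum>t=1..T. (if t = 1 then 1 else 0) + norm u * (D * b t)) / real T"
  proof (intro divide_right_mono sum_mono)
    fix t assume t: "t \<in> {1..T}"
    have "0 \<le> norm u * (D * b t)" using b0[of t] c by (simp add: D_def)
    then show "?d t \<le> (if t = 1 then 1 else 0) + norm u * (D * b t)"
      using d1[OF t] d2[of t] t by (cases "t = 1") auto
  qed auto
  also have "(\<Sum>t=1..T. (if t = 1 then 1 else 0) + norm u * (D * b t))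
      = 1 + norm u * (D * (\<Sum>t=1..T. b t))"
    using T by (simp add: sum.distrib sum_distrib_left)
  finally show ?thesis using T by (simp add: D_def add_divide_distrib)
qed

subsection \<open>A measurable bound of the gradient\<close>

text \<open>A limit along a sequence keeps measurability in a further variable, which a partial
  derivative obtained through \<open>frechet_derivative\<close> does not exhibit directly.\<close>

lemma partial_difference_quotient_tendsto:
  fixes f :: "real ^ 'k \<Rightarrow> real"
  assumes "f differentiable (at v)"
  shows "(\<lambda>n. (f (v + (1 / real (Suc n)) *\<^sub>R axis k 1) - f v) * real (Suc n)) \<longlonglongrightarrow> partial k f v"
proof -
  let ?f' = "frechet_derivative f (at v)" and ?e = "axis k 1 :: real ^ 'k"
  have f': "(f has_derivative ?f') (at v)" using assms frechet_derivative_works by blast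
  have "((\<lambda>h. f (v + h *\<^sub>R ?e)) has_derivative (\<lambda>h. ?f' (h *\<^sub>R ?e))) (at 0)"
    by (rule has_derivative_compose[of "\<lambda>h. v + h *\<^sub>R ?e"])
      (auto intro!: derivative_eq_intros simp: f')
  moreover have "(\<lambda>h. ?f' (h *\<^sub>R ?e)) = (*) (?f' ?e)"
    using linear_cmul[OF has_derivative_linear[OF f']] by (auto simp: mult.commute)
  ultimately have "((\<lambda>h. f (v + h *\<^sub>R ?e)) has_real_derivative ?f' ?e) (at 0)"
    by (simp add: has_field_derivative_def)
  then have "((\<lambda>h. (f (v + h *\<^sub>R ?e) - f v) / h) \<longlongrightarrow> ?f' ?e) (at 0)"
    by (simp add: DERIV_def)
  moreover have "filterlim (\<lambda>n. 1 / real (Suc n)) (at 0) sequentially"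
    using LIMSEQ_Suc[OF lim_1_over_n] by (auto simp: filterlim_at)
  ultimately have "(\<lambda>n. (f (v + (1 / real (Suc n)) *\<^sub>R ?e) - f v) / (1 / real (Suc n))) \<longlonglongrightarrow> ?f' ?e"
    by (rule filterlim_compose)
  then show ?thesis by (simp add: partial_def)
qed

text \<open>Differences are used only at points of \<open>\<Omega>\<close>, where the functions to which this is applied are
  measurable in the sample point; with a countable \<open>D\<close> the supremum then is measurable as well.\<close>

definition partial_sup ::
    "(real ^ 'k) set \<Rightarrow> (real ^ 'k) set \<Rightarrow> 'k \<Rightarrow> (real ^ 'k \<Rightarrow> real) \<Rightarrow> ennreal" where
  "partial_sup \<Omega> D k f = (SUP v\<in>D. liminf (\<lambda>n.
     if v + (1 / real (Suc n)) *\<^sub>R axis k 1 \<in> \<Omega>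
     then ennreal \<bar>(f (v + (1 / real (Suc n)) *\<^sub>R axis k 1) - f v) * real (Suc n)\<bar> else 0))"

lemma borel_measurable_partial_sup:
  assumes "countable D" "D \<subseteq> \<Omega>" "\<And>v. v \<in> \<Omega> \<Longrightarrow> (\<lambda>z. f z v) \<in> borel_measurable N"
  shows "(\<lambda>z. partial_sup \<Omega> D k (f z)) \<in> borel_measurable N"
  unfolding partial_sup_def
proof (intro borel_measurable_SUP assms(1) borel_measurable_liminf)
  fix v n assume "v \<in> D"
  with assms show "(\<lambda>z. if v + (1 / real (Suc n)) *\<^sub>R axis k 1 \<in> \<Omega>
     then ennreal \<bar>(f z (v + (1 / real (Suc n)) *\<^sub>R axis k 1) - f z v) * real (Suc n)\<bar> else 0)
     \<in> borel_measurable N"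
    by (cases "v + (1 / real (Suc n)) *\<^sub>R axis k 1 \<in> \<Omega>")
      (auto intro!: measurable_compose[OF _ measurable_ennreal] borel_measurable_abs
         borel_measurable_times borel_measurable_diff)
qed

text \<open>As \<open>U\<close> is open, the points
  \<open>v + (1 / real (Suc n)) *\<^sub>R axis k 1\<close> eventually lie in \<open>U\<close>, hence
  in \<open>\<Omega>\<close>, so the default value 0 does not affect the \<open>liminf\<close>.
  Continuity of the partial derivative then extends the supremum from the dense set \<open>D\<close>
  to \<open>U\<close>.\<close>

lemma partial_sup_eq:
  fixes f :: "real ^ 'k \<Rightarrow> real"
  assumes U: "open U" "U \<subseteq> \<Omega>" "D \<subseteq> U" "U \<subseteq> closure D" and f: "C1_on U f"
  shows "partial_sup \<Omega> D k f = (SUP v\<in>U. ennreal \<bar>partial k f v\<bar>)"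
proof -
  have "liminf (\<lambda>n. if v + (1 / real (Suc n)) *\<^sub>R axis k 1 \<in> \<Omega>
     then ennreal \<bar>(f (v + (1 / real (Suc n)) *\<^sub>R axis k 1) - f v) * real (Suc n)\<bar> else 0)
     = ennreal \<bar>partial k f v\<bar>" if v: "v \<in> D" for v
  proof (rule lim_imp_Liminf)
    have "(\<lambda>n. v + (1 / real (Suc n)) *\<^sub>R axis k 1) \<longlonglongrightarrow> v + 0 *\<^sub>R (axis k 1 :: real ^ 'k)"
      using LIMSEQ_Suc[OF lim_1_over_n] by (intro tendsto_intros) auto
    then have "\<forall>\<^sub>F n in sequentially. v + (1 / real (Suc n)) *\<^sub>R axis k 1 \<in> U"
      by (rule topological_tendstoD) (use U v in auto)
    then have ev: "\<forall>\<^sub>F n in sequentially.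
        ennreal \<bar>(f (v + (1 / real (Suc n)) *\<^sub>R axis k 1) - f v) * real (Suc n)\<bar>
        = (if v + (1 / real (Suc n)) *\<^sub>R axis k 1 \<in> \<Omega>
     then ennreal \<bar>(f (v + (1 / real (Suc n)) *\<^sub>R axis k 1) - f v) * real (Suc n)\<bar> else 0)"
      by eventually_elim (use U in auto)
    have "f differentiable (at v)" using f v U by (auto simp: C1_on_def)
    then have "(\<lambda>n. ennreal \<bar>(f (v + (1 / real (Suc n)) *\<^sub>R axis k 1) - f v) * real (Suc n)\<bar>)
        \<longlonglongrightarrow> ennreal \<bar>partial k f v\<bar>"
      by (intro tendsto_ennrealI tendsto_rabs partial_difference_quotient_tendsto)
    then show "(\<lambda>n. if v + (1 / real (Suc n)) *\<^sub>R axis k 1 \<in> \<Omega>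
     then ennreal \<bar>(f (v + (1 / real (Suc n)) *\<^sub>R axis k 1) - f v) * real (Suc n)\<bar> else 0)
        \<longlonglongrightarrow> ennreal \<bar>partial k f v\<bar>"
      by (rule Lim_transform_eventually[OF _ ev])
  qed simp
  then have *: "partial_sup \<Omega> D k f = (SUP v\<in>D. ennreal \<bar>partial k f v\<bar>)"
    unfolding partial_sup_def by (intro SUP_cong) auto
  show ?thesis
  proof (rule antisym)
    show "partial_sup \<Omega> D k f \<le> (SUP v\<in>U. ennreal \<bar>partial k f v\<bar>)"
      unfolding * by (rule SUP_subset_mono) (use U in auto)
    have cont: "continuous_on U (partial k f)" using f by (auto simp: C1_on_def)
    show "(SUP v\<in>U. ennreal \<bar>partial k f v\<bar>) \<le> partial_sup \<Omega> D k f"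
    proof (rule SUP_least)
      fix v assume v: "v \<in> U"
      obtain s where s: "\<And>n. s n \<in> D" "s \<longlonglongrightarrow> v"
        using U(4) v closure_sequential[of v D] by auto
      have "continuous (at v) (partial k f)" using cont U(1) v continuous_on_eq_continuous_at by blast
      then have "(\<lambda>n. partial k f (s n)) \<longlonglongrightarrow> partial k f v"
        using s(2) isCont_tendsto_compose by blast
      then have "(\<lambda>n. ennreal \<bar>partial k f (s n)\<bar>) \<longlonglongrightarrow> ennreal \<bar>partial k f v\<bar>"
        by (intro tendsto_ennrealI tendsto_rabs)
      then show "ennreal \<bar>partial k f v\<bar> \<le> partial_sup \<Omega> D k f"
      proof (rule LIMSEQ_le_const2)
        have "ennreal \<bar>partial k f (s n)\<bar> \<le> partial_sup \<Omega> D k f" for n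
          unfolding * by (rule SUP_upper[OF s(1)])
        then show "\<exists>N. \<forall>n\<ge>N. ennreal \<bar>partial k f (s n)\<bar> \<le> partial_sup \<Omega> D k f" by blast
      qed
    qed
  qed
qed

text \<open>Mean value inequality on a convex set; the operator norm of the derivative is at most
  the sum of the absolute partial derivatives.\<close>

lemma partial_bound_imp_Lipschitz:
  fixes f :: "real ^ 'k \<Rightarrow> real"
  assumes f: "\<And>v. v \<in> ball v0 r \<Longrightarrow> f differentiable (at v)"
    and s: "\<And>v k. v \<in> ball v0 r \<Longrightarrow> \<bar>partial k f v\<bar> \<le> s k"
    and v: "v \<in> ball v0 r"
  shows "\<bar>f v - f v0\<bar> \<le> (\<Sum>k\<in>UNIV. s k) * dist v v0"
proof -
  have "norm (f v - f v0) \<le> (\<Sum>k\<in>UNIV. s k) * norm (v - v0)"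
  proof (rule differentiable_bound[of "ball v0 r" f "\<lambda>y. frechet_derivative f (at y)"])
    fix y assume y: "y \<in> ball v0 r"
    have d: "(f has_derivative frechet_derivative f (at y)) (at y)"
      using f[OF y] frechet_derivative_works by blast
    then show "(f has_derivative frechet_derivative f (at y)) (at y within ball v0 r)"
      by (rule has_derivative_at_withinI)
    have lin: "linear (frechet_derivative f (at y))" using d by (rule has_derivative_linear)
    show "onorm (frechet_derivative f (at y)) \<le> (\<Sum>k\<in>UNIV. s k)"
    proof (rule onorm_le)
      fix h :: "real ^ 'k"
      have "frechet_derivative f (at y) h = frechet_derivative f (at y) (\<Sum>k\<in>UNIV. h $ k *\<^sub>R axis k 1)"
        using basis_expansion[of h] by (simp add: scalar_mult_eq_scaleR)
      also have "\<dots> = (\<Sum>k\<in>UNIV. h $ k * partial k f y)"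
        by (simp add: linear_sum[OF lin] linear_cmul[OF lin] partial_def)
      also have "\<bar>\<dots>\<bar> \<le> (\<Sum>k\<in>UNIV. \<bar>h $ k * partial k f y\<bar>)" by (rule sum_abs)
      also have "\<dots> \<le> (\<Sum>k\<in>UNIV. norm h * s k)"
        unfolding abs_mult by (intro sum_mono mult_mono component_le_norm_cart s y) auto
      finally show "norm (frechet_derivative f (at y) h) \<le> (\<Sum>k\<in>UNIV. s k) * norm h"
        by (simp add: mult.commute flip: sum_distrib_left)
    qed
  qed (use v in \<open>auto intro: le_less_trans[OF zero_le_dist]\<close>)
  then show ?thesis by (simp add: dist_norm)
qed

text \<open>The \<open>nn_integral\<close> in \<open>fin\<close> is a lower integral, as its integrand need not be measurable; hence it
  need not be additive, nor the same for all \<open>t\<close>. Therefore the envelope \<open>V\<close> is built from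
  \<open>partial_sup\<close>, a measurable function of the past that agrees with the supremum almost surely.\<close>

lemma (in prob_space) gradient_envelope:
  fixes x :: "int \<Rightarrow> 'a \<Rightarrow> real ^ 'd" and \<mu> :: "real ^ 'k \<Rightarrow> (nat \<Rightarrow> real ^ 'd) \<Rightarrow> real ^ 'd"
  assumes \<mu>: "\<And>\<theta>. \<theta> \<in> \<Omega> \<Longrightarrow> \<mu> \<theta> \<in> borel_measurable (\<Pi>\<^sub>M i\<in>UNIV. borel)"
    and x: "strictly_stationary M x"
    and C2: "AE \<omega> in M. \<forall>t j. C2_on (interior \<Omega>) (\<lambda>\<theta>. \<mu> \<theta> (past x t \<omega>) $ j)"
    and U: "open U" "\<theta>0 \<in> U" "U \<subseteq> interior \<Omega>"
    and fin: "\<And>t j k. (\<integral>\<^sup>+\<omega>. ennreal ((norm (x t \<omega>))\<^sup>2) * (SUP \<theta>\<in>U. ennreal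
        \<bar>partial k (\<lambda>\<theta>. \<mu> \<theta> (past x (t - 1) \<omega>) $ j) \<theta>
          * partial k (\<lambda>\<theta>. \<mu> \<theta> (past x (t - 1) \<omega>) $ j) \<theta>\<bar>) \<partial>M) < \<infinity>"
  obtains r :: real and V :: "int \<Rightarrow> 'a \<Rightarrow> ennreal" and C :: real
  where "0 < r" "ball \<theta>0 r \<subseteq> \<Omega>" "\<And>t. V t \<in> borel_measurable M" "\<And>t. (\<integral>\<^sup>+\<omega>. V t \<omega> \<partial>M) = ennreal C"
    "AE \<omega> in M. \<forall>t. V t \<omega> < \<infinity> \<and> (\<forall>j. \<forall>\<theta>\<in>ball \<theta>0 r.
       norm (x t \<omega>) * \<bar>\<mu> \<theta> (past x (t - 1) \<omega>) $ j - \<mu> \<theta>0 (past x (t - 1) \<omega>) $ j\<bar>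
         \<le> enn2real (V t \<omega>) * dist \<theta> \<theta>0)"
proof -
  obtain r where r: "0 < r" "ball \<theta>0 r \<subseteq> U" using U openE by blast
  have U\<Omega>: "U \<subseteq> \<Omega>" using U interior_subset by blast
  obtain D where D: "countable D" "D \<subseteq> U" "U \<subseteq> closure D" by (rule separable)
  have D\<Omega>: "D \<subseteq> \<Omega>" using D U\<Omega> by auto
  define P where "P j k z = partial_sup \<Omega> D k (\<lambda>\<theta>. \<mu> \<theta> z $ j)" for j k z
  have P [measurable]: "P j k \<in> borel_measurable (\<Pi>\<^sub>M i\<in>UNIV. borel)" for j k
    unfolding P_def using \<mu> by (intro borel_measurable_partial_sup D D\<Omega>) auto
  have [measurable]: "x t \<in> borel_measurable M" for t using x by (auto simp: strictly_stationary_def)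
  have past [measurable]: "past x t \<in> measurable M (\<Pi>\<^sub>M i\<in>UNIV. borel)" for t
    unfolding past_def[abs_def] by (intro measurable_PiM_single') auto
  define V where "V t \<omega> = (\<Sum>j\<in>UNIV. \<Sum>k\<in>UNIV. ennreal (norm (x t \<omega>)) * P j k (past x (t - 1) \<omega>))" for t \<omega>
  have V [measurable]: "V t \<in> borel_measurable M" for t unfolding V_def by measurable
  have C1: "AE \<omega> in M. \<forall>t j. C1_on U (\<lambda>\<theta>. \<mu> \<theta> (past x t \<omega>) $ j)"
    using C2
  proof eventually_elim
    case (elim \<omega>)
    then show ?case using U(3) unfolding C2_on_def C1_on_def by (meson continuous_on_subset subsetD)
  qed
  have P_eq: "AE \<omega> in M. \<forall>t j k. P j k (past x t \<omega>)
      = (SUP \<theta>\<in>U. ennreal \<bar>partial k (\<lambda>\<theta>. \<mu> \<theta> (past x t \<omega>) $ j) \<theta>\<bar>)"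
    using C1
  proof eventually_elim
    case (elim \<omega>)
    show ?case unfolding P_def
      by (intro allI partial_sup_eq[OF U(1) U\<Omega> D(2,3)]) (use elim in blast)
  qed
  have P_fin: "(\<integral>\<^sup>+\<omega>. ennreal (norm (x t \<omega>)) * P j k (past x (t - 1) \<omega>) \<partial>M) < \<infinity>" (is "?I < _") for t j k
  proof -
    let ?h = "\<lambda>\<omega>. ennreal (norm (x t \<omega>)) * P j k (past x (t - 1) \<omega>)"
    let ?g = "\<lambda>\<omega>. ennreal ((norm (x t \<omega>))\<^sup>2) * (SUP \<theta>\<in>U. ennreal
        \<bar>partial k (\<lambda>\<theta>. \<mu> \<theta> (past x (t - 1) \<omega>) $ j) \<theta>
          * partial k (\<lambda>\<theta>. \<mu> \<theta> (past x (t - 1) \<omega>) $ j) \<theta>\<bar>)"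
    \<comment> \<open>From \<open>y \<le> 1 + y\<^sup>2\<close>. The constant stands on the left
      because \<open>?g\<close> need not be measurable: monotonicity holds for its lower integral,
      while additivity is used only for the measurable \<open>?h \<omega> - 1\<close>.\<close>
    have "AE \<omega> in M. ?h \<omega> - 1 \<le> ?g \<omega>"
      using P_eq
    proof eventually_elim
      case (elim \<omega>)
      let ?p = "\<lambda>\<theta>. partial k (\<lambda>\<theta>. \<mu> \<theta> (past x (t - 1) \<omega>) $ j) \<theta>" and ?n = "norm (x t \<omega>)"
      have "?h \<omega> = (SUP \<theta>\<in>U. ennreal (?n * \<bar>?p \<theta>\<bar>))"
        by (simp add: elim SUP_mult_left_ennreal ennreal_mult)
      also have "\<dots> \<le> 1 + ?g \<omega>"
      proof (rule SUP_least)
        fix \<theta> assume "\<theta> \<in> U"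
        have "(?n * \<bar>?p \<theta>\<bar>)\<^sup>2 = ?n\<^sup>2 * \<bar>?p \<theta> * ?p \<theta>\<bar>"
          by (simp add: power2_eq_square abs_mult mult_ac)
        moreover have "0 \<le> ?n * \<bar>?p \<theta>\<bar>" by simp
        moreover have "2 * (?n * \<bar>?p \<theta>\<bar>) \<le> 1 + (?n * \<bar>?p \<theta>\<bar>)\<^sup>2"
          using sum_squares_bound[of 1 "?n * \<bar>?p \<theta>\<bar>"] by simp
        ultimately have "?n * \<bar>?p \<theta>\<bar> \<le> 1 + ?n\<^sup>2 * \<bar>?p \<theta> * ?p \<theta>\<bar>" by linarith
        then have "ennreal (?n * \<bar>?p \<theta>\<bar>) \<le> ennreal (1 + ?n\<^sup>2 * \<bar>?p \<theta> * ?p \<theta>\<bar>)" by (rule ennreal_leI)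
        also have "\<dots> = 1 + ennreal (?n\<^sup>2) * ennreal \<bar>?p \<theta> * ?p \<theta>\<bar>"
          by (simp add: ennreal_mult ennreal_plus)
        also have "\<dots> \<le> 1 + ?g \<omega>"
          by (intro add_left_mono mult_left_mono SUP_upper \<open>\<theta> \<in> U\<close>) auto
        finally show "ennreal (?n * \<bar>?p \<theta>\<bar>) \<le> 1 + ?g \<omega>" .
      qed
      finally show ?case by (simp add: ennreal_minus_le_iff)
    qed
    then have "(\<integral>\<^sup>+\<omega>. ?h \<omega> - 1 \<partial>M) \<le> (\<integral>\<^sup>+\<omega>. ?g \<omega> \<partial>M)" by (rule nn_integral_mono_AE)
    also have "\<dots> < \<infinity>" by (rule fin)
    finally have "(\<integral>\<^sup>+\<omega>. 1 + (?h \<omega> - 1) \<partial>M) < \<infinity>"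
      by (subst nn_integral_add) (auto simp: emeasure_space_1)
    \<comment> \<open>Only an inequality, since subtraction in \<open>ennreal\<close> is truncated
      at 0.\<close>
    moreover have "(\<integral>\<^sup>+\<omega>. ?h \<omega> \<partial>M) \<le> (\<integral>\<^sup>+\<omega>. 1 + (?h \<omega> - 1) \<partial>M)"
    proof (rule nn_integral_mono)
      fix \<omega>
      show "?h \<omega> \<le> 1 + (?h \<omega> - 1)"
        using order_refl[of "?h \<omega> - 1"] unfolding ennreal_minus_le_iff by blast
    qed
    ultimately show ?thesis by (rule le_less_trans[rotated])
  qed
  have V_fin: "(\<integral>\<^sup>+\<omega>. V t \<omega> \<partial>M) < \<infinity>" for t
    unfolding V_def using P_fin by (subst nn_integral_sum) (auto simp: nn_integral_sum)
  have V_const: "(\<integral>\<^sup>+\<omega>. V t \<omega> \<partial>M) = (\<integral>\<^sup>+\<omega>. V 0 \<omega> \<partial>M)" for t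
  proof -
    \<comment> \<open>The observation sits at index 0 and its past at -1, -2, and so on. Thus
      \<open>V t\<close> is one fixed functional of the path shifted by \<open>t\<close>, and
      stationarity applies.\<close>
    define Vp where "Vp z = (\<Sum>j\<in>UNIV. \<Sum>k\<in>UNIV. ennreal (norm (z 0)) * P j k (\<lambda>i. z (- 1 - int i)))"
      for z :: "int \<Rightarrow> real ^ 'd"
    have [measurable]: "(\<lambda>z i. z (- 1 - int i)) \<in> measurable (\<Pi>\<^sub>M t\<in>UNIV. borel) (\<Pi>\<^sub>M i\<in>UNIV. (borel :: (real ^ 'd) measure))"
      by (intro measurable_PiM_single') auto
    have Vp: "Vp \<in> borel_measurable (\<Pi>\<^sub>M t\<in>UNIV. borel)" unfolding Vp_def by measurable
    have "V t \<omega> = Vp (\<lambda>s. x (s + t) \<omega>)" for t \<omega>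
      by (simp add: V_def Vp_def past_def algebra_simps)
    from this[of t] this[of 0] show ?thesis
      using strictly_stationary_nn_integral[OF x Vp, of t] by simp
  qed
  have "AE \<omega> in M. \<forall>t. V t \<omega> \<noteq> \<infinity>"
    unfolding AE_all_countable using V_fin by (intro allI nn_integral_PInf_AE V) (simp add: less_top)
  then have main: "AE \<omega> in M. \<forall>t. V t \<omega> < \<infinity> \<and> (\<forall>j. \<forall>\<theta>\<in>ball \<theta>0 r.
       norm (x t \<omega>) * \<bar>\<mu> \<theta> (past x (t - 1) \<omega>) $ j - \<mu> \<theta>0 (past x (t - 1) \<omega>) $ j\<bar>
         \<le> enn2real (V t \<omega>) * dist \<theta> \<theta>0)"
    using C1 P_eq
  proof eventually_elim
    case (elim \<omega>)
    show ?case
    proof (intro allI conjI ballI)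
      fix t j \<theta> assume \<theta>: "\<theta> \<in> ball \<theta>0 r"
      let ?f = "\<lambda>\<theta>. \<mu> \<theta> (past x (t - 1) \<omega>) $ j" and ?n = "norm (x t \<omega>)"
      let ?P = "\<lambda>k. P j k (past x (t - 1) \<omega>)"
      show "?n * \<bar>?f \<theta> - ?f \<theta>0\<bar> \<le> enn2real (V t \<omega>) * dist \<theta> \<theta>0"
      \<comment> \<open>If \<open>x t \<omega> = 0\<close>, then \<open>V t \<omega>\<close> is 0
        even where the gradient bound is infinite, so its finiteness says nothing about the
        gradient; but the left side vanishes too.\<close>
      proof (cases "x t \<omega> = 0")
        case False
        have PV: "ennreal ?n * ?P k \<le> V t \<omega>" for k
        proof -
          have "ennreal ?n * ?P k \<le> (\<Sum>k\<in>UNIV. ennreal ?n * ?P k)"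
            by (rule member_le_sum) auto
          also have "\<dots> \<le> V t \<omega>" unfolding V_def
            by (rule member_le_sum[of j UNIV "\<lambda>j. \<Sum>k\<in>UNIV. ennreal ?n * P j k (past x (t - 1) \<omega>)"]) auto
          finally show ?thesis .
        qed
        have Pfin: "?P k < \<infinity>" for k
        proof -
          have "ennreal ?n * ?P k < \<infinity>"
            using PV[of k] elim(1) by (auto simp: less_top intro: le_less_trans)
          then show ?thesis using False by (auto simp: ennreal_mult_less_top)
        qed
        define s where "s k = enn2real (?P k)" for k
        have s: "ennreal (s k) = ?P k" for k using Pfin[of k] by (simp add: s_def)
        have s0: "0 \<le> s k" for k by (simp add: s_def)
        have "\<bar>?f \<theta> - ?f \<theta>0\<bar> \<le> (\<Sum>k\<in>UNIV. s k) * dist \<theta> \<theta>0"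
        proof (rule partial_bound_imp_Lipschitz[of \<theta>0 r])
          fix v k assume v: "v \<in> ball \<theta>0 r"
          then have vU: "v \<in> U" using r by auto
          then show "?f differentiable (at v)" using elim(2) by (auto simp: C1_on_def)
          have "ennreal \<bar>partial k ?f v\<bar> \<le> ?P k"
            using elim(3) vU by (auto intro!: SUP_upper)
          then show "\<bar>partial k ?f v\<bar> \<le> s k"
            unfolding s[symmetric] by (simp only: ennreal_le_iff[OF s0])
        qed (rule \<theta>)
        then have "?n * \<bar>?f \<theta> - ?f \<theta>0\<bar> \<le> (?n * (\<Sum>k\<in>UNIV. s k)) * dist \<theta> \<theta>0"
          unfolding mult.assoc by (rule mult_left_mono) simp
        also have "\<dots> \<le> enn2real (V t \<omega>) * dist \<theta> \<theta>0"
        proof (intro mult_right_mono)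
          have "ennreal (?n * (\<Sum>k\<in>UNIV. s k)) = (\<Sum>k\<in>UNIV. ennreal ?n * ?P k)"
            unfolding s[symmetric] using s0
            by (simp add: ennreal_mult sum_nonneg sum_distrib_left flip: sum_ennreal)
          also have "\<dots> \<le> V t \<omega>" unfolding V_def
            by (rule member_le_sum[of j UNIV "\<lambda>j. \<Sum>k\<in>UNIV. ennreal ?n * P j k (past x (t - 1) \<omega>)"]) auto
          finally have "enn2real (ennreal (?n * (\<Sum>k\<in>UNIV. s k))) \<le> enn2real (V t \<omega>)"
            using elim(1) by (intro enn2real_mono) (auto simp: less_top)
          then show "?n * (\<Sum>k\<in>UNIV. s k) \<le> enn2real (V t \<omega>)"
            by (simp add: s0 sum_nonneg)
        qed auto
        finally show ?thesis .
      qed simp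
    qed (use elim(1) in \<open>auto simp: less_top\<close>)
  qed
  show ?thesis
  proof (rule that[OF r(1) _ V _ main])
    show "ball \<theta>0 r \<subseteq> \<Omega>" using r U\<Omega> by auto
    show "(\<integral>\<^sup>+\<omega>. V t \<omega> \<partial>M) = ennreal (enn2real (\<integral>\<^sup>+\<omega>. V 0 \<omega> \<partial>M))" for t
      using V_const[of t] V_fin[of 0] by simp
  qed
qed

theorem theorem2:
  fixes M :: "'w measure"
    and x \<epsilon> :: "int \<Rightarrow> 'w \<Rightarrow> real ^ 'd"
    and F\<^sub>\<epsilon> :: "(real ^ 'd) measure"
    and \<mu> :: "real ^ 'k \<Rightarrow> (nat \<Rightarrow> real ^ 'd) \<Rightarrow> real ^ 'd"
    and g :: "real ^ 'k \<Rightarrow> (nat \<Rightarrow> real ^ 'd) \<Rightarrow> (nat \<Rightarrow> real ^ 'd) \<Rightarrow> real ^ 'd"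
    and x0 m0 :: "real ^ 'k \<Rightarrow> nat \<Rightarrow> real ^ 'd"
    and \<theta>0 :: "real ^ 'k" and \<Omega>0 U :: "(real ^ 'k) set"
    and \<omega>0 K0 \<rho> :: real
    and W :: "real ^ 'd \<Rightarrow> real"
    and \<theta>hat :: "nat \<Rightarrow> 'w \<Rightarrow> real ^ 'k"
    and m :: "int \<Rightarrow> 'w \<Rightarrow> real ^ 'k"
    and \<Phi> :: "(real ^ 'r) set" and G :: "real ^ 'r \<Rightarrow> (real ^ 'd) measure"
    and \<phi>hat :: "nat \<Rightarrow> 'w \<Rightarrow> real ^ 'r" and \<phi>A :: "real ^ 'r"
  defines "\<mu>fin \<equiv> \<lambda>\<theta> t \<omega>. mu_finite g x0 m0 \<theta> (\<lambda>s. x (int s) \<omega>) t"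
  defines "\<mu>hat \<equiv> \<lambda>T t \<omega>. \<mu>fin (\<theta>hat T \<omega>) (t - 1) \<omega>"
  defines "\<epsilon>hat \<equiv> \<lambda>T t \<omega>. x (int t) \<omega> \<oslash> \<mu>hat T t \<omega>"
  defines "S \<equiv> \<lambda>T \<omega>. test_stat W (\<lambda>t. \<epsilon>hat T t \<omega>) (G (\<phi>hat T \<omega>)) T"
  assumes "prob_space M"
    \<comment> \<open>innovations\<close>
    and eps_indep: "prob_space.indep_vars M (\<lambda>_. borel) \<epsilon> UNIV"
    and eps_law: "\<And>t. distr M borel (\<epsilon> t) = F\<^sub>\<epsilon>"
    and eps_nonneg: "AE y in F\<^sub>\<epsilon>. 0 \<le> y"
    and eps_mean: "integrable F\<^sub>\<epsilon> (\<lambda>y. y)" "(\<integral>y. y \<partial>F\<^sub>\<epsilon>) = 1"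
    \<comment> \<open>the conditional-mean function, for the infinite and for the finite past\<close>
    and mu_measurable:
      "\<And>\<theta>. \<theta> \<in> \<Omega>0 \<Longrightarrow> \<mu> \<theta> \<in> borel_measurable (\<Pi>\<^sub>M i\<in>UNIV. borel)"
    and g_measurable:
      "\<And>\<theta>. \<theta> \<in> \<Omega>0 \<Longrightarrow> case_prod (g \<theta>)
         \<in> borel_measurable ((\<Pi>\<^sub>M i\<in>UNIV. borel) \<Otimes>\<^sub>M (\<Pi>\<^sub>M i\<in>UNIV. borel))"
    and mu_recursion:
      "AE \<omega> in M. \<forall>t. \<forall>\<theta>\<in>\<Omega>0. \<mu> \<theta> (past x t \<omega>) =
         g \<theta> (past x t \<omega>) (\<lambda>i. \<mu> \<theta> (past x (t - 1 - int i) \<omega>))"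
    \<comment> \<open>(A1)\<close>
    and x_stationary: "strictly_stationary M x"
    and x_ergodic: "ergodic_process M x"
    and x_nonneg: "\<And>t. AE \<omega> in M. 0 \<le> x t \<omega>"
    and vMEM: "\<And>t. AE \<omega> in M. x t \<omega> = \<mu> \<theta>0 (past x (t - 1) \<omega>) * \<epsilon> t \<omega>"
    and cond_mean: "\<And>t j. AE \<omega> in M.
      real_cond_exp M (sigma_of M x {..t - 1}) (\<lambda>\<omega>. x t \<omega> $ j) \<omega>
        = \<mu> \<theta>0 (past x (t - 1) \<omega>) $ j"
    and Omega0: "compact \<Omega>0" "\<theta>0 \<in> \<Omega>0"
    and omega0: "0 < \<omega>0"
    and mu_lower: "AE \<omega> in M. \<forall>t. \<forall>\<theta>\<in>\<Omega>0. \<forall>j. \<omega>0 \<le> \<mu> \<theta> (past x t \<omega>) $ j"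
    and mu_fin_lower: "AE \<omega> in M. \<forall>t. \<forall>\<theta>\<in>\<Omega>0. \<forall>j. \<omega>0 \<le> \<mu>fin \<theta> t \<omega> $ j"
    and K0_rho: "0 < K0" "0 < \<rho>" "\<rho> < 1"
    and mu_fin_approx: "AE \<omega> in M. \<forall>t\<ge>1. \<forall>\<theta>\<in>\<Omega>0.
      norm (\<mu>fin \<theta> t \<omega> - \<mu> \<theta> (past x (int t) \<omega>)) < K0 * \<rho> ^ t"
    \<comment> \<open>(A4)\<close>
    and mu_C2: "AE \<omega> in M. \<forall>t j. C2_on (interior \<Omega>0) (\<lambda>\<theta>. \<mu> \<theta> (past x t \<omega>) $ j)"
    and x_integrable: "\<And>t. integrable M (\<lambda>\<omega>. norm (x t \<omega>))"
    and A4_score: "\<And>t j k. (\<integral>\<^sup>+\<omega>. ennreal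
        (\<bar>partial k (\<lambda>\<theta>. \<mu> \<theta> (past x (t - 1) \<omega>) $ j) \<theta>0\<bar>
          * (\<epsilon> t \<omega> $ j / \<mu> \<theta>0 (past x (t - 1) \<omega>) $ j)) \<partial>M) < \<infinity>"
    and U: "open U" "\<theta>0 \<in> U" "U \<subseteq> interior \<Omega>0"
    and A4_first: "\<And>t j k l. (\<integral>\<^sup>+\<omega>. ennreal ((norm (x t \<omega>))\<^sup>2) * (SUP \<theta>\<in>U. ennreal
        \<bar>partial k (\<lambda>\<theta>. \<mu> \<theta> (past x (t - 1) \<omega>) $ j) \<theta>
          * partial l (\<lambda>\<theta>. \<mu> \<theta> (past x (t - 1) \<omega>) $ j) \<theta>\<bar>) \<partial>M) < \<infinity>"
    and A4_second: "\<And>t j k l. (\<integral>\<^sup>+\<omega>. ennreal \<bar>x t \<omega> $ j\<bar> * (SUP \<theta>\<in>U. ennreal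
        \<bar>partial k (partial l (\<lambda>\<theta>. \<mu> \<theta> (past x (t - 1) \<omega>) $ j)) \<theta>\<bar>) \<partial>M) < \<infinity>"
    \<comment> \<open>(A5)\<close>
    and W_nonneg: "\<And>u. u \<in> pos_orthant \<Longrightarrow> 0 \<le> W u"
    and W_integrable: "set_integrable lborel pos_orthant W"
    and W_moment: "set_integrable lborel pos_orthant (\<lambda>u. norm u ^ 4 * W u)"
    \<comment> \<open>the estimator of the model parameter\<close>
    and theta_estimator: "\<And>T. \<theta>hat T \<in> borel_measurable (sigma_of M x {1..int T})"
    and m_stationary: "strictly_stationary M m"
    and m_mds: "martingale_differences M (\<lambda>t. sigma_of M \<epsilon> {..t}) m"
    and m_variance: "\<And>t k. integrable M (\<lambda>\<omega>. (m t \<omega> $ k)\<^sup>2)"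
    and theta_expansion: "conv_in_prob M
      (\<lambda>T \<omega>. sqrt (real T) *\<^sub>R (\<theta>hat T \<omega> - \<theta>0)
              - (1 / sqrt (real T)) *\<^sub>R (\<Sum>t=1..T. m (int t) \<omega>)) 0"
    \<comment> \<open>the parametric family and the estimator of its parameter\<close>
    and G_distribution: "\<And>\<phi>. \<phi> \<in> \<Phi> \<Longrightarrow>
      prob_space (G \<phi>) \<and> sets (G \<phi>) = sets borel \<and> (AE y in G \<phi>. y \<in> pos_orthant)"
    and phi_estimator: "\<And>T. \<phi>hat T \<in> borel_measurable (sigma_of M x {1..int T})"
    and phi_values: "\<And>T \<omega>. \<omega> \<in> space M \<Longrightarrow> \<phi>hat T \<omega> \<in> \<Phi>"
    and alternative: "F\<^sub>\<epsilon> \<notin> G ` \<Phi>"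
    and phi_A: "\<phi>A \<in> \<Phi>"
    and laplace_conv: "conv_in_prob M
      (\<lambda>T \<omega>. SUP u\<in>pos_orthant. \<bar>laplace (G (\<phi>hat T \<omega>)) u - laplace (G \<phi>A) u\<bar>) 0"
  shows "conv_in_prob M (\<lambda>T \<omega>. S T \<omega> / real T)
    (LINT u:pos_orthant|lborel.
       \<bar>prob_space.expectation M (\<lambda>\<omega>. exp (- (u \<bullet> \<epsilon> 1 \<omega>))) - laplace (G \<phi>A) u\<bar>\<^sup>2 * W u)"
proof -
  interpret prob_space M by fact
  have \<epsilon> [measurable]: "\<epsilon> t \<in> borel_measurable M" for t
    using eps_indep by (auto simp: indep_vars_def)
  have x [measurable]: "x t \<in> borel_measurable M" for t
    using x_stationary by (auto simp: strictly_stationary_def)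

  \<comment> \<open>The weight extended by zero, and its moments\<close>
  define w where "w u = indicator pos_orthant u * W u" for u
  have w_nonneg: "0 \<le> w u" for u using W_nonneg by (auto simp: w_def indicator_def)
  have w_out: "u \<notin> pos_orthant \<Longrightarrow> w u = 0" for u by (simp add: w_def)
  have w_int: "integrable lborel w"
    using W_integrable by (simp add: set_integrable_def w_def[abs_def])
  then have [measurable]: "w \<in> borel_measurable borel" by auto
  have w_int1: "integrable lborel (\<lambda>u. norm u * w u)"
  proof (rule Bochner_Integration.integrable_bound)
    have "integrable lborel (\<lambda>u. norm u ^ 4 * w u)"
      using W_moment by (simp add: set_integrable_def w_def[abs_def] mult_ac)
    with w_int show "integrable lborel (\<lambda>u. w u + norm u ^ 4 * w u)"
      by (rule Bochner_Integration.integrable_add)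
    \<comment> \<open>Obtains the first moment of the weight from its mass and fourth moment; the
      residual bound is linear in \<open>norm u\<close>.\<close>
    have "y \<le> 1 + y ^ 4" if "0 \<le> y" for y :: real
      using that self_le_power[of y 4] by (cases "y \<le> 1") (auto intro: add_increasing2)
    then have "norm u * w u \<le> (1 + norm u ^ 4) * w u" for u
      using w_nonneg by (intro mult_right_mono) auto
    then show "AE u in lborel. norm (norm u * w u) \<le> norm (w u + norm u ^ 4 * w u)"
      using w_nonneg by (auto simp: distrib_right)
  qed measurable
  define W0 where "W0 = (\<integral>u. w u \<partial>lborel)"
  define W1 where "W1 = (\<integral>u. norm u * w u \<partial>lborel)"

  \<comment> \<open>Consistency, and the averages that control the residuals\<close>
  have cons: "conv_in_prob M (\<lambda>T \<omega>. \<theta>hat T \<omega> - \<theta>0) 0"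
    by (rule estimator_consistent[OF \<epsilon> m_stationary m_mds m_variance theta_expansion])
  obtain r :: real and V :: "int \<Rightarrow> 'w \<Rightarrow> ennreal" and C :: real where r: "0 < r" "ball \<theta>0 r \<subseteq> \<Omega>0"
    and V [measurable]: "\<And>t. V t \<in> borel_measurable M" and V_int: "\<And>t. (\<integral>\<^sup>+\<omega>. V t \<omega> \<partial>M) = ennreal C"
    and env: "AE \<omega> in M. \<forall>t. V t \<omega> < \<infinity> \<and> (\<forall>j. \<forall>\<theta>\<in>ball \<theta>0 r.
       norm (x t \<omega>) * \<bar>\<mu> \<theta> (past x (t - 1) \<omega>) $ j - \<mu> \<theta>0 (past x (t - 1) \<omega>) $ j\<bar>
         \<le> enn2real (V t \<omega>) * dist \<theta> \<theta>0)"
    by (rule gradient_envelope[of \<Omega>0 \<mu> x U \<theta>0, OF mu_measurable x_stationary mu_C2 U A4_first]) (assumption, rule that)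

  \<comment> \<open>The exponent is \<open>t - 1\<close> because the conditional mean at time
    \<open>t\<close> is computed from the data up to \<open>t - 1\<close>. \<open>P\<close> carries
    the effect of the initial values, \<open>Q\<close> that of the estimated parameter.\<close>
  define P where "P T \<omega> = (\<Sum>t=1..T. ennreal (norm (x (int t) \<omega>) * (\<rho> ^ (t - 1) / real T)))" for T \<omega>
  define Q where "Q T \<omega> = (\<Sum>t=1..T. V (int t) \<omega> * ennreal (1 / real T))" for T \<omega>
  have P_m [measurable]: "P T \<in> borel_measurable M" for T unfolding P_def by measurable
  have Q_m [measurable]: "Q T \<in> borel_measurable M" for T unfolding Q_def by measurable
  have Q_bound: "(\<integral>\<^sup>+\<omega>. Q T \<omega> \<partial>M) \<le> ennreal C" for T
  proof -
    have "(\<integral>\<^sup>+\<omega>. Q T \<omega> \<partial>M) = (\<Sum>t=1..T. ennreal C * ennreal (1 / real T))"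
      unfolding Q_def by (subst nn_integral_sum) (auto simp: nn_integral_multc V_int)
    also have "\<dots> = ennreal C * (ennreal (real T) * ennreal (1 / real T))"
      by (simp add: ennreal_of_nat_eq_real_of_nat mult_ac)
    also have "ennreal (real T) * ennreal (1 / real T) = ennreal (real T * (1 / real T))"
      by (rule ennreal_mult[symmetric]) auto
    also have "ennreal C * ennreal (real T * (1 / real T)) \<le> ennreal C * 1"
      by (intro mult_left_mono) (cases "T = 0", auto)
    finally show ?thesis by simp
  qed
  have Q_conv: "conv_in_prob M (\<lambda>T \<omega>. norm (\<theta>hat T \<omega> - \<theta>0) * enn2real (Q T \<omega>)) 0"
    by (rule conv_in_prob_mult_bounded[OF conv_in_prob_norm_le[OF cons, of _ 1] Q_m Q_bound]) simp

  define X0 where "X0 = expectation (\<lambda>\<omega>. norm (x 0 \<omega>))"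
  have X0: "0 \<le> X0" unfolding X0_def by (intro integral_nonneg_AE) auto
  have x_norm: "(\<integral>\<^sup>+\<omega>. ennreal (norm (x t \<omega>)) \<partial>M) = ennreal X0" for t
    using strictly_stationary_nn_integral[OF x_stationary, of "\<lambda>z. ennreal (norm (z 0))" t]
      nn_integral_eq_integral[OF x_integrable[of 0]] by (simp add: X0_def)
  have P_bound: "(\<integral>\<^sup>+\<omega>. P T \<omega> \<partial>M) \<le> ennreal (X0 / (1 - \<rho>) / real T)" for T
  proof -
    have summand: "(\<integral>\<^sup>+\<omega>. ennreal (norm (x t \<omega>) * c) \<partial>M) = ennreal (X0 * c)" if "0 \<le> c" for t c
      using that X0 by (simp add: ennreal_mult nn_integral_multc x_norm)
    have geom: "(\<Sum>t=1..T. \<rho> ^ (t - 1)) \<le> 1 / (1 - \<rho>)"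
    proof -
      have "(\<Sum>t=1..T. \<rho> ^ (t - 1)) = (\<Sum>t<T. \<rho> ^ t)"
        by (rule sum.reindex_bij_witness[of _ Suc "\<lambda>t. t - 1"]) auto
      also have "\<dots> \<le> (\<Sum>t. \<rho> ^ t)"
        using K0_rho by (intro sum_le_suminf) (auto intro: summable_geometric)
      also have "\<dots> = 1 / (1 - \<rho>)" using K0_rho by (simp add: suminf_geometric)
      finally show ?thesis .
    qed
    have "(\<integral>\<^sup>+\<omega>. P T \<omega> \<partial>M) = (\<Sum>t=1..T. \<integral>\<^sup>+\<omega>. ennreal (norm (x (int t) \<omega>) * (\<rho> ^ (t - 1) / real T)) \<partial>M)"
      unfolding P_def by (rule nn_integral_sum) measurable
    also have "\<dots> = (\<Sum>t=1..T. ennreal (X0 * (\<rho> ^ (t - 1) / real T)))"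
      using K0_rho by (intro sum.cong refl summand) auto
    also have "\<dots> = ennreal (\<Sum>t=1..T. X0 * (\<rho> ^ (t - 1) / real T))"
      using K0_rho X0 by (intro sum_ennreal) auto
    also have "(\<Sum>t=1..T. X0 * (\<rho> ^ (t - 1) / real T)) = X0 * (\<Sum>t=1..T. \<rho> ^ (t - 1)) / real T"
      by (simp add: sum_distrib_left sum_divide_distrib)
    also have "ennreal \<dots> \<le> ennreal (X0 * (1 / (1 - \<rho>)) / real T)"
      using X0 by (intro ennreal_leI divide_right_mono mult_left_mono geom) auto
    finally show ?thesis by simp
  qed
  have P_lim: "(\<lambda>T. \<integral>\<^sup>+\<omega>. P T \<omega> \<partial>M) \<longlonglongrightarrow> 0"
    using tendsto_ennrealI[OF lim_const_over_n[of "X0 / (1 - \<rho>)"]]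
    unfolding ennreal_0 by (rule tendsto_0_ennreal_le[OF always_eventually[OF allI[OF P_bound]]])
  have P_conv: "conv_in_prob M (\<lambda>T \<omega>. enn2real (P T \<omega>)) 0"
    by (rule conv_in_prob_Markov[OF P_m P_lim])

  \<comment> \<open>The transforms of the innovations and of the fitted family\<close>
  define a where "a u = expectation (\<lambda>\<omega>. exp (- (u \<bullet> \<epsilon> 1 \<omega>)))" for u
  have a_m: "a \<in> borel_measurable borel" unfolding a_def[abs_def] by measurable
  have eps_AE: "AE \<omega> in M. 0 \<le> \<epsilon> t \<omega>" for t
    using eps_nonneg unfolding eps_law[of t, symmetric] by (subst (asm) AE_distr_iff) auto
  have a_unit: "a u \<in> {0..1}" if "u \<in> pos_orthant" for u
  proof -
    have "AE \<omega> in M. norm (exp (- (u \<bullet> \<epsilon> 1 \<omega>))) \<le> 1"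
      using eps_AE[of 1] by eventually_elim (simp add: inner_nonneg_vec[OF that])
    moreover from this have "integrable M (\<lambda>\<omega>. exp (- (u \<bullet> \<epsilon> 1 \<omega>)))"
      by (rule integrable_const_bound) measurable
    ultimately have "a u \<le> expectation (\<lambda>\<omega>. 1)"
      unfolding a_def by (intro integral_mono_AE) auto
    moreover have "0 \<le> a u" unfolding a_def by (intro integral_nonneg_AE) auto
    ultimately show ?thesis by (simp add: prob_space)
  qed
  define N where "N T \<omega> =
      (\<integral>\<^sup>+u. ennreal (\<bar>emp_laplace (\<lambda>t. \<epsilon> (int t) \<omega>) T u - a u\<bar> * w u) \<partial>lborel)" for T \<omega>
  have N_conv: "conv_in_prob M (\<lambda>T \<omega>. enn2real (N T \<omega>)) 0"
    unfolding N_def a_def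
    by (intro conv_in_prob_Markov tendsto_integrated_empirical_laplace[OF eps_indep eps_law eps_nonneg w_int
          w_nonneg w_out])

  define s where "s T \<omega> =
      (SUP u\<in>pos_orthant. \<bar>laplace (G (\<phi>hat T \<omega>)) u - laplace (G \<phi>A) u\<bar>)" for T \<omega>
  have s_conv: "conv_in_prob M s 0" using laplace_conv unfolding s_def .
  have G_unit: "laplace (G \<phi>) u \<in> {0..1}" if "\<phi> \<in> \<Phi>" "u \<in> pos_orthant" for \<phi> u
    using laplace_bounds[of "G \<phi>" u] G_distribution[OF that(1)] that(2) by auto
  \<comment> \<open>A real \<open>SUP\<close> is an upper bound only for a family bounded above;
    here 1 is a bound because both transforms lie in \<open>[0, 1]\<close>.\<close>
  have s_upper: "\<bar>laplace (G (\<phi>hat T \<omega>)) u - laplace (G \<phi>A) u\<bar> \<le> s T \<omega>"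
    if "\<omega> \<in> space M" "u \<in> pos_orthant" for T \<omega> u
    unfolding s_def
  proof (rule cSUP_upper[OF that(2)])
    show "bdd_above ((\<lambda>u. \<bar>laplace (G (\<phi>hat T \<omega>)) u - laplace (G \<phi>A) u\<bar>) ` pos_orthant)"
    proof (rule bdd_aboveI2)
      fix u :: "real ^ 'd" assume u: "u \<in> pos_orthant"
      show "\<bar>laplace (G (\<phi>hat T \<omega>)) u - laplace (G \<phi>A) u\<bar> \<le> 1"
        using G_unit[OF phi_values[OF that(1)] u, of T] G_unit[OF phi_A u] by auto
    qed
  qed

  \<comment> \<open>The pathwise bound and the conclusion\<close>
  define D where "D = real CARD('d) / \<omega>0\<^sup>2"
  \<comment> \<open>This is the bound of \<open>weighted_square_distance_bound\<close> with
    \<open>p = 1 / T\<close>, \<open>q = D * (K0 * P + \<delta> * Q)\<close>, where \<delta> is the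
    estimation error, and \<open>s\<close> the uniform distance of the fitted transforms, multiplied
    out so that each summand has its own limit.\<close>
  define X where "X T \<omega> = 2 * W0 * (1 / real T) + (2 * W1 * D * K0 * enn2real (P T \<omega>)
      + (2 * W1 * D * (norm (\<theta>hat T \<omega> - \<theta>0) * enn2real (Q T \<omega>))
      + (2 * enn2real (N T \<omega>) + 2 * W0 * s T \<omega>)))" for T \<omega>
  have "conv_in_prob M X (0 + (0 + (0 + (0 + 0))))"
    unfolding X_def
    by (intro conv_in_prob_add conv_in_prob_cmult P_conv Q_conv N_conv s_conv
        conv_in_prob_deterministic lim_1_over_n)
  then have X_conv: "conv_in_prob M X 0" by simp

  define L where "L = (\<integral>u. (a u - laplace (G \<phi>A) u)\<^sup>2 * w u \<partial>lborel)"
  have L_eq: "L = (LINT u:pos_orthant|lborel.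
       \<bar>prob_space.expectation M (\<lambda>\<omega>. exp (- (u \<bullet> \<epsilon> 1 \<omega>))) - laplace (G \<phi>A) u\<bar>\<^sup>2 * W u)"
    by (simp add: L_def a_def w_def set_lebesgue_integral_def mult_ac)
  \<comment> \<open>There are countably many times, so one null set serves all \<open>t\<close> and
    hence all \<open>T\<close>.\<close>
  have "AE \<omega> in M. \<forall>t. x t \<omega> = \<mu> \<theta>0 (past x (t - 1) \<omega>) * \<epsilon> t \<omega>" "AE \<omega> in M. \<forall>t. 0 \<le> x t \<omega>"
    "AE \<omega> in M. \<forall>t. 0 \<le> \<epsilon> t \<omega>"
    unfolding AE_all_countable using vMEM x_nonneg eps_AE by auto
  with env mu_lower mu_fin_lower mu_fin_approx AE_space
  have main: "AE \<omega> in M. \<forall>T\<ge>1. norm (\<theta>hat T \<omega> - \<theta>0) < r \<longrightarrow> \<bar>S T \<omega> / real T - L\<bar> \<le> X T \<omega>"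
  proof eventually_elim
    case (elim \<omega>)
    show ?case
    proof (intro allI impI)
      fix T :: nat assume T: "1 \<le> T" and close: "norm (\<theta>hat T \<omega> - \<theta>0) < r"
      define \<delta> where "\<delta> = norm (\<theta>hat T \<omega> - \<theta>0)"
      have ball: "\<theta>hat T \<omega> \<in> ball \<theta>0 r" using close by (simp add: dist_norm norm_minus_commute)
      \<comment> \<open>The estimator is not assumed to take values in \<open>\<Omega>0\<close>;
        closeness to \<open>\<theta>0\<close> puts it there, so the bounds on the conditional mean
        apply to it.\<close>
      then have \<theta>\<Omega>: "\<theta>hat T \<omega> \<in> \<Omega>0" using r by auto
      define b where "b t = norm (x (int t) \<omega>) * (K0 * \<rho> ^ (t - 1)) + enn2real (V (int t) \<omega>) * \<delta>" for t
      define q where "q = D * ((\<Sum>t=1..T. b t) / real T)"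
      let ?A = "emp_laplace (\<lambda>t. \<epsilon>hat T t \<omega>) T" and ?L = "emp_laplace (\<lambda>t. \<epsilon> (int t) \<omega>) T"
      have int1: "int (t - 1) = int t - 1" if "t \<in> {1..T}" for t using that by auto
      have eh_nonneg: "0 \<le> \<epsilon>hat T t \<omega>" for t
        unfolding \<epsilon>hat_def \<mu>hat_def vec_div_def less_eq_vec_def
      proof
        fix j
        have "0 \<le> x (int t) \<omega> $ j" using elim by (auto simp: less_eq_vec_def)
        moreover have "\<omega>0 \<le> \<mu>fin (\<theta>hat T \<omega>) (t - 1) \<omega> $ j" using elim \<theta>\<Omega> by blast
        ultimately show "0 $ j \<le> (\<chi> j. x (int t) \<omega> $ j / \<mu>fin (\<theta>hat T \<omega>) (t - 1) \<omega> $ j) $ j"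
          using omega0 by simp
      qed
      have b_bound: "norm (x (int t) \<omega>) * \<bar>\<mu>hat T t \<omega> $ j - \<mu> \<theta>0 (past x (int t - 1) \<omega>) $ j\<bar> \<le> b t"
        if t: "t \<in> {2..T}" for t j
      proof -
        \<comment> \<open>Intermediate point: estimated parameter, infinite past. One step replaces
          the past, the other the parameter. \<open>t \<ge> 2\<close> gives
          \<open>t - 1 \<ge> 1\<close>, the range in which the two pasts are compared.\<close>
        let ?\<nu> = "\<mu> (\<theta>hat T \<omega>) (past x (int t - 1) \<omega>)"
        have t1: "int (t - 1) = int t - 1" "1 \<le> t - 1" using t by auto
        have "\<bar>\<mu>hat T t \<omega> $ j - ?\<nu> $ j\<bar> = \<bar>(\<mu>hat T t \<omega> - ?\<nu>) $ j\<bar>" by simp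
        also have "\<dots> \<le> norm (\<mu>hat T t \<omega> - ?\<nu>)" by (rule component_le_norm_cart)
        also have "\<dots> \<le> K0 * \<rho> ^ (t - 1)"
          using elim(4)[rule_format, OF t1(2) \<theta>\<Omega>] unfolding t1(1) \<mu>hat_def by simp
        finally have 1: "\<bar>\<mu>hat T t \<omega> $ j - ?\<nu> $ j\<bar> \<le> K0 * \<rho> ^ (t - 1)" .
        have 2: "norm (x (int t) \<omega>) * \<bar>?\<nu> $ j - \<mu> \<theta>0 (past x (int t - 1) \<omega>) $ j\<bar>
            \<le> enn2real (V (int t) \<omega>) * \<delta>"
          using elim(1) ball unfolding \<delta>_def by (simp add: dist_norm)
        have "\<bar>\<mu>hat T t \<omega> $ j - \<mu> \<theta>0 (past x (int t - 1) \<omega>) $ j\<bar>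
            \<le> K0 * \<rho> ^ (t - 1) + \<bar>?\<nu> $ j - \<mu> \<theta>0 (past x (int t - 1) \<omega>) $ j\<bar>"
          using 1 by linarith
        then have "norm (x (int t) \<omega>) * \<bar>\<mu>hat T t \<omega> $ j - \<mu> \<theta>0 (past x (int t - 1) \<omega>) $ j\<bar>
            \<le> norm (x (int t) \<omega>) * (K0 * \<rho> ^ (t - 1) + \<bar>?\<nu> $ j - \<mu> \<theta>0 (past x (int t - 1) \<omega>) $ j\<bar>)"
          by (rule mult_left_mono) simp
        with 2 show ?thesis by (simp add: b_def distrib_left)
      qed
      have AL: "\<bar>?A u - ?L u\<bar> \<le> 1 / real T + norm u * q" if "u \<in> pos_orthant" for u
        unfolding q_def D_def \<epsilon>hat_def
      proof (rule emp_laplace_residuals_bound[where \<nu> = "\<lambda>t. \<mu> \<theta>0 (past x (int t - 1) \<omega>)", OF _ that omega0])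
        show "0 \<le> b t" for t using K0_rho by (simp add: b_def \<delta>_def)
        show "\<omega>0 \<le> \<mu> \<theta>0 (past x (int t - 1) \<omega>) $ j" for t j using elim Omega0 by blast
        show "\<omega>0 \<le> \<mu>hat T t \<omega> $ j" for t j using elim \<theta>\<Omega> unfolding \<mu>hat_def by blast
      qed (use T elim b_bound in auto)
      have "S T \<omega> / real T = (\<integral>u. (?A u - laplace (G (\<phi>hat T \<omega>)) u)\<^sup>2 * w u \<partial>lborel)"
        using T by (simp add: S_def test_stat_def w_def set_lebesgue_integral_def mult_ac)
      also have "\<bar>\<dots> - L\<bar> \<le> 2 * ((1 / real T) * (\<integral>u. w u \<partial>lborel) + q * (\<integral>u. norm u * w u \<partial>lborel)
          + (\<integral>u. \<bar>?L u - a u\<bar> * w u \<partial>lborel) + s T \<omega> * (\<integral>u. w u \<partial>lborel))"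
        unfolding L_def
      proof (rule weighted_square_distance_bound)
        show "?A \<in> borel_measurable borel" "?L \<in> borel_measurable borel"
          unfolding emp_laplace_def[abs_def] by measurable
        show "laplace (G (\<phi>hat T \<omega>)) \<in> borel_measurable borel" "laplace (G \<phi>A) \<in> borel_measurable borel"
          using G_distribution[OF phi_A] G_distribution[OF phi_values[OF elim(5)]]
          by (auto intro!: borel_measurable_laplace)
        show "?A u \<in> {0..1} \<and> ?L u \<in> {0..1} \<and> a u \<in> {0..1} \<and> laplace (G (\<phi>hat T \<omega>)) u \<in> {0..1}
            \<and> laplace (G \<phi>A) u \<in> {0..1}" if u: "u \<in> pos_orthant" for u
          using emp_laplace_bounds[of T "\<lambda>t. \<epsilon>hat T t \<omega>", OF eh_nonneg u]
            emp_laplace_bounds[of T "\<lambda>t. \<epsilon> (int t) \<omega>", OF _ u] elim(8)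
            a_unit[OF u] G_unit[OF phi_values[OF elim(5)] u] G_unit[OF phi_A u]
          by auto
      qed (use a_m w_int w_int1 w_nonneg w_out AL s_upper elim in auto)
      also have "(\<integral>u. \<bar>?L u - a u\<bar> * w u \<partial>lborel) = enn2real (N T \<omega>)"
        unfolding N_def using a_m w_nonneg
        by (intro integral_eq_nn_integral) (auto simp: emp_laplace_def)
      also have "q = D * (K0 * enn2real (P T \<omega>) + \<delta> * enn2real (Q T \<omega>))"
      proof -
        have "P T \<omega> = ennreal (\<Sum>t=1..T. norm (x (int t) \<omega>) * (\<rho> ^ (t - 1) / real T))"
          unfolding P_def using K0_rho by (intro sum_ennreal) auto
        then have p: "enn2real (P T \<omega>) = (\<Sum>t=1..T. norm (x (int t) \<omega>) * (\<rho> ^ (t - 1) / real T))"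
          using K0_rho by (simp add: sum_nonneg)
        have "Q T \<omega> = (\<Sum>t=1..T. ennreal (enn2real (V (int t) \<omega>) * (1 / real T)))"
          unfolding Q_def
        proof (intro sum.cong refl)
          fix t
          \<comment> \<open>Finiteness is essential here, since \<open>enn2real\<close> maps
            infinity to 0.\<close>
          have "V (int t) \<omega> < top" using elim(1) by simp
          then show "V (int t) \<omega> * ennreal (1 / real T) = ennreal (enn2real (V (int t) \<omega>) * (1 / real T))"
            by (subst ennreal_mult) auto
        qed
        also have "\<dots> = ennreal (\<Sum>t=1..T. enn2real (V (int t) \<omega>) * (1 / real T))"
          by (intro sum_ennreal) auto
        finally have "enn2real (Q T \<omega>) = (\<Sum>t=1..T. enn2real (V (int t) \<omega>) * (1 / real T))"
          by (simp add: sum_nonneg)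
        with p show ?thesis
          by (simp add: q_def b_def sum.distrib sum_distrib_left sum_divide_distrib add_divide_distrib mult_ac)
      qed
      finally show "\<bar>S T \<omega> / real T - L\<bar> \<le> X T \<omega>"
        by (simp add: X_def \<delta>_def W0_def W1_def algebra_simps)
    qed
  qed
  show ?thesis
    unfolding L_eq[symmetric]
  proof (rule conv_in_prob_dominated[OF cons r(1) X_conv])
    show "\<forall>\<^sub>F T in sequentially. AE \<omega> in M. dist (\<theta>hat T \<omega> - \<theta>0) 0 < r \<longrightarrow>
        dist (S T \<omega> / real T) L \<le> X T \<omega>"
      using eventually_ge_at_top[of 1]
    proof eventually_elim
      case (elim T)
      show ?case using main by eventually_elim (use elim in \<open>auto simp: dist_real_def\<close>)
    qed
  qed
qed

end
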